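(* Let $A>0$, $\sigma=0$, and $p(x)=\frac12e^{-|x|}$. Set $A_1=\frac{-A+\sqrt{A^2+4}}{2}$ and $A_2=\frac{-A-\sqrt{A^2+4}}{2}$. The system $$u_t-u_{txx}-Au_x+3uu_x+(1+\eta)\eta_x=0,\qquad \eta_t+\big((1+\eta)u\big)_x=0$$ admits a solitary wave of speed $c\in\mathbb{R}$ if and only if $c>A_1$ or $c<A_2$. Moreover, every solitary wave $(\varphi,\eta)$ of this system is smooth, i.e. $\varphi,\eta\in C^\infty(\mathbb{R})$.
   Context: A solitary wave of speed $c$ is a pair $(\varphi,\eta)\in H^1(\mathbb{R})\times H^1(\mathbb{R})$, not identically zero, with $\varphi,\eta\to0$ as $|x|\to\infty$, such that in $\mathcal{D}'(\mathbb{R})$ $$\Big[-c\varphi+p\ast\Big(-A\varphi+\tfrac{3}{2}\varphi^2+\tfrac12(1+\eta)^2\Big)\Big]_x=0,\qquad \big[-c\eta+(1+\eta)\varphi\big]_x=0,$$ i.e. $(u,\eta)(t,x)=(\varphi(x-ct),\eta(x-ct))$ is a weak traveling-wave solution. *)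

theory Defs
  imports "HOL-Analysis.Analysis"
begin

definition smooth_fun :: "(real \<Rightarrow> real) \<Rightarrow> bool" where
  "smooth_fun f \<longleftrightarrow> (\<exists>D :: nat \<Rightarrow> real \<Rightarrow> real. D 0 = f \<and>
      (\<forall>k x. (D k has_real_derivative D (Suc k) x) (at x)))"

definition test_fun :: "(real \<Rightarrow> real) \<Rightarrow> bool" where
  "test_fun \<psi> \<longleftrightarrow> smooth_fun \<psi> \<and> (\<exists>a b. \<forall>x. x \<notin> {a..b} \<longrightarrow> \<psi> x = 0)"

definition L2_fun :: "(real \<Rightarrow> real) \<Rightarrow> bool" where
  "L2_fun f \<longleftrightarrow> f \<in> borel_measurable lborel \<and> integrable lborel (\<lambda>x. (f x)\<^sup>2)"

definition H1_fun :: "(real \<Rightarrow> real) \<Rightarrow> bool" where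
  "H1_fun f \<longleftrightarrow> L2_fun f \<and> (\<exists>g. L2_fun g \<and>
      (\<forall>\<psi>. test_fun \<psi> \<longrightarrow>
         (LINT x|lborel. f x * deriv \<psi> x) = - (LINT x|lborel. g x * \<psi> x)))"

definition distr_deriv_zero :: "(real \<Rightarrow> real) \<Rightarrow> bool" where
  "distr_deriv_zero F \<longleftrightarrow> (\<forall>\<psi>. test_fun \<psi> \<longrightarrow> (LINT x|lborel. F x * deriv \<psi> x) = 0)"

definition pker :: "real \<Rightarrow> real" where
  "pker x = exp (- \<bar>x\<bar>) / 2"

definition pconv :: "(real \<Rightarrow> real) \<Rightarrow> real \<Rightarrow> real" where
  "pconv f x = (LINT y|lborel. pker (x - y) * f y)"

text \<open>Solitary wave of speed c (continuous representatives of H^1 functions).\<close>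
definition solitary_wave :: "real \<Rightarrow> real \<Rightarrow> (real \<Rightarrow> real) \<Rightarrow> (real \<Rightarrow> real) \<Rightarrow> bool" where
  "solitary_wave A c \<phi> \<eta> \<longleftrightarrow>
     H1_fun \<phi> \<and> H1_fun \<eta> \<and> continuous_on UNIV \<phi> \<and> continuous_on UNIV \<eta> \<and>
     (\<exists>x. \<phi> x \<noteq> 0 \<or> \<eta> x \<noteq> 0) \<and>
     (\<phi> \<longlongrightarrow> 0) at_top \<and> (\<phi> \<longlongrightarrow> 0) at_bot \<and>
     (\<eta> \<longlongrightarrow> 0) at_top \<and> (\<eta> \<longlongrightarrow> 0) at_bot \<and>
     distr_deriv_zero (\<lambda>x. - c * \<phi> x +
        pconv (\<lambda>y. - A * \<phi> y + 3/2 * (\<phi> y)\<^sup>2 + 1/2 * (1 + \<eta> y)\<^sup>2) x) \<and>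
     distr_deriv_zero (\<lambda>x. - c * \<eta> x + (1 + \<eta> x) * \<phi> x)"

end

theory Submission
  imports Defs "HOL-Computational_Algebra.Polynomial"
begin

text \<open>By the du Bois-Reymond lemma the two equations integrate to \<open>(1 + \<eta>) \<phi> = c \<eta>\<close> and
  \<open>p * F = c \<phi> + 1/2\<close>. For \<open>c = 0\<close> they force \<open>\<phi>\<close> and \<open>\<eta>\<close> into a finite set of values, hence
  \<open>\<phi> = \<eta> = 0\<close>. For \<open>c > 0\<close> the first one gives \<open>\<phi> < c\<close> and \<open>\<eta> = \<phi> / (c - \<phi>)\<close>; since \<open>p\<close> is the
  Green function of \<open>1 - d\<^sup>2/dx\<^sup>2\<close>, the second one is an ODE \<open>\<phi>'' = g(\<phi>)\<close> with \<open>g\<close> smooth, so \<open>\<phi>\<close> is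
  smooth, and it has the first integral
  \<open>c (c - \<phi>) \<phi>'\<^sup>2 = \<phi>\<^sup>2 ((c - \<phi>) (c + A - \<phi>) - 1) = \<phi>\<^sup>2 (c - A\<^sub>1 - \<phi>) (c - A\<^sub>2 - \<phi>)\<close>.
  Its right-hand side is negative for small \<open>\<phi> \<noteq> 0\<close> if \<open>c < A\<^sub>1\<close> and has no admissible nonzero turning
  point if \<open>c = A\<^sub>1\<close>; if \<open>c > A\<^sub>1\<close>, quadrature produces a pulse of height \<open>c - A\<^sub>1\<close>.
  The symmetry \<open>(A, c, \<phi>) \<mapsto> (- A, - c, - \<phi>)\<close> reduces \<open>c < 0\<close> to \<open>c > 0\<close>.\<close>

section \<open>Smooth functions\<close>

text \<open>Differentiability n times, by recursion on n with an existential witness at each level.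
  Closure under products and inverses, and later the bootstrap for the wave, then run by induction
  on n instead of exhibiting a whole sequence of derivatives at once.\<close>

primrec diff_class :: "nat \<Rightarrow> (real \<Rightarrow> real) \<Rightarrow> bool" where
  "diff_class 0 f \<longleftrightarrow> True"
| "diff_class (Suc n) f \<longleftrightarrow> (\<exists>g. (\<forall>x. (f has_real_derivative g x) (at x)) \<and> diff_class n g)"

lemma diff_class_SucI:
  "(\<And>x. (f has_real_derivative g x) (at x)) \<Longrightarrow> diff_class n g \<Longrightarrow> diff_class (Suc n) f"
  by auto

lemma diff_class_SucD: "diff_class (Suc n) f \<Longrightarrow> diff_class n f"
proof (induction n arbitrary: f)
  case (Suc n)
  then obtain g where "\<And>x. (f has_real_derivative g x) (at x)" "diff_class (Suc n) g"
    by (subst (asm) (2) diff_class.simps(2)) blast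
  with Suc.IH show ?case by (blast intro: diff_class_SucI)
qed simp

lemma diff_class_deriv:
  assumes "\<And>n. diff_class n f"
  shows "(f has_real_derivative deriv f x) (at x)" "diff_class n (deriv f)"
proof -
  have *: "\<And>n. \<exists>g. (\<forall>x. (f has_real_derivative g x) (at x)) \<and> diff_class n g"
    using assms diff_class.simps(2) by blast
  then show "(f has_real_derivative deriv f x) (at x)"
    using DERIV_imp_deriv by (metis (no_types))
  obtain g where g: "\<And>x. (f has_real_derivative g x) (at x)" "diff_class n g"
    using * by blast
  have "deriv f = g" using g(1) DERIV_imp_deriv by blast
  with g(2) show "diff_class n (deriv f)" by simp
qed

text \<open>Witnesses from different levels agree because derivatives are unique, so the iterates of
  \<open>deriv\<close> form one sequence that serves all levels.\<close>

lemma smooth_fun_iff_diff_class: "smooth_fun f \<longleftrightarrow> (\<forall>n. diff_class n f)"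
proof
  assume "smooth_fun f"
  then obtain D where D: "D 0 = f" "\<And>k x. (D k has_real_derivative D (Suc k) x) (at x)"
    unfolding smooth_fun_def by metis
  have "diff_class n (D k)" for n k
  proof (induction n arbitrary: k)
    case (Suc n)
    show ?case by (rule diff_class_SucI[OF D(2) Suc])
  qed simp
  then show "\<forall>n. diff_class n f" using D(1) by metis
next
  assume f: "\<forall>n. diff_class n f"
  have *: "\<forall>n. diff_class n ((deriv ^^ k) f)" for k
    by (induction k) (simp_all add: f diff_class_deriv(2))
  show "smooth_fun f"
    unfolding smooth_fun_def
    by (rule exI[of _ "\<lambda>k. (deriv ^^ k) f"]) (simp add: * diff_class_deriv(1))
qed

lemma diff_class_const: "diff_class n (\<lambda>_. a)"
proof (induction n arbitrary: a)
  case (Suc n)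
  show ?case by (rule diff_class_SucI[OF _ Suc[of 0]]) simp
qed simp

lemma diff_class_add: "diff_class n f \<Longrightarrow> diff_class n g \<Longrightarrow> diff_class n (\<lambda>x. f x + g x)"
proof (induction n arbitrary: f g)
  case (Suc n)
  from Suc.prems obtain f' g'
    where "\<And>x. (f has_real_derivative f' x) (at x)" "diff_class n f'"
      "\<And>x. (g has_real_derivative g' x) (at x)" "diff_class n g'" by auto
  then show ?case
    by (intro diff_class_SucI[OF _ Suc.IH[of f' g']]) (auto intro: DERIV_add)
qed simp

lemma diff_class_mult: "diff_class n f \<Longrightarrow> diff_class n g \<Longrightarrow> diff_class n (\<lambda>x. f x * g x)"
proof (induction n arbitrary: f g)
  case (Suc n)
  from Suc.prems obtain f' g'
    where d: "\<And>x. (f has_real_derivative f' x) (at x)" "diff_class n f'"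
      "\<And>x. (g has_real_derivative g' x) (at x)" "diff_class n g'" by auto
  have "diff_class n f" "diff_class n g"
    using Suc.prems diff_class_SucD by blast+
  then have "diff_class n (\<lambda>x. f' x * g x + g' x * f x)"
    using d by (intro diff_class_add Suc.IH) auto
  then show ?case
    using d by (intro diff_class_SucI[of _ "\<lambda>x. f' x * g x + g' x * f x"]) (auto intro: DERIV_mult)
qed simp

lemma diff_class_minus: "diff_class n f \<Longrightarrow> diff_class n (\<lambda>x. - f x)"
  using diff_class_mult[OF diff_class_const[of n "-1"], of f] by simp

lemma diff_class_diff: "diff_class n f \<Longrightarrow> diff_class n g \<Longrightarrow> diff_class n (\<lambda>x. f x - g x)"
  using diff_class_add[of n f "\<lambda>x. - g x"] diff_class_minus by simp

lemma diff_class_inverse: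
  "diff_class n f \<Longrightarrow> (\<And>x. f x \<noteq> 0) \<Longrightarrow> diff_class n (\<lambda>x. inverse (f x))"
proof (induction n arbitrary: f)
  case (Suc n)
  from Suc.prems obtain f'
    where d: "\<And>x. (f has_real_derivative f' x) (at x)" "diff_class n f'" by auto
  have "diff_class n (\<lambda>x. inverse (f x))"
    using Suc diff_class_SucD by blast
  then have "diff_class n (\<lambda>x. - (inverse (f x) * f' x * inverse (f x)))"
    using d by (intro diff_class_minus diff_class_mult) auto
  then show ?case
    using d Suc.prems(2)
    by (intro diff_class_SucI[of _ "\<lambda>x. - (inverse (f x) * f' x * inverse (f x))"])
      (auto intro: DERIV_inverse')
qed simp

lemma diff_class_shift: "diff_class n f \<Longrightarrow> diff_class n (\<lambda>x. f (a * x + b))"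
proof (induction n arbitrary: f)
  case (Suc n)
  from Suc.prems obtain f'
    where d: "\<And>x. (f has_real_derivative f' x) (at x)" "diff_class n f'" by auto
  have "((\<lambda>x. f (a * x + b)) has_real_derivative f' (a * x + b) * a) (at x)" for x
    by (rule DERIV_chain2[OF d(1)]) (auto intro!: derivative_eq_intros)
  moreover have "diff_class n (\<lambda>x. f' (a * x + b) * a)"
    by (rule diff_class_mult[OF Suc.IH[OF d(2)] diff_class_const])
  ultimately show ?case by (rule diff_class_SucI)
qed simp

section \<open>Flat functions modelled on exp (- 1 / x)\<close>

definition flat_poly :: "real poly \<Rightarrow> real \<Rightarrow> real" where
  "flat_poly P x = (if x > 0 then poly P (1 / x) * exp (- (1 / x)) else 0)"

lemma poly_times_exp_minus_tendsto_0:
  "((\<lambda>t::real. poly P t * exp (- t)) \<longlongrightarrow> 0) at_top"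
proof -
  have "((\<lambda>t. \<Sum>i\<le>degree P. coeff P i * (t ^ i / exp t)) \<longlongrightarrow> (\<Sum>i\<le>degree P. coeff P i * 0)) at_top"
    by (intro tendsto_sum tendsto_mult tendsto_const tendsto_power_div_exp_0)
  then show ?thesis
    by (simp add: poly_altdef sum_divide_distrib exp_minus field_simps)
qed

text \<open>For x > 0 the derivative of P(1/x) exp (- 1/x) is (1/x)^2 (P - P')(1/x) exp (- 1/x),
  again a member of the family. Closure under differentiation yields derivatives of every order in
  one induction.\<close>

lemma flat_poly_deriv:
  "(flat_poly P has_real_derivative flat_poly ([:0, 0, 1:] * (P - pderiv P)) x) (at x)"
proof -
  consider "x > 0" | "x < 0" | "x = 0" by linarith
  then show ?thesis
  proof cases
    case 1
    have "((\<lambda>x. poly P (1 / x) * exp (- (1 / x))) has_real_derivative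
        flat_poly ([:0, 0, 1:] * (P - pderiv P)) x) (at x)"
    proof -
      have i: "((\<lambda>x. 1 / x) has_real_derivative - ((1 / x) * (1 / x))) (at x)"
        using 1 DERIV_inverse'[OF DERIV_ident, of x UNIV] by (simp add: inverse_eq_divide)
      have "((\<lambda>x. poly P (1 / x) * exp (- (1 / x))) has_real_derivative
          poly (pderiv P) (1 / x) * - ((1 / x) * (1 / x)) * exp (- (1 / x)) +
          exp (- (1 / x)) * - (- ((1 / x) * (1 / x))) * poly P (1 / x)) (at x)"
        by (intro DERIV_mult DERIV_chain2[OF poly_DERIV i] DERIV_chain2[OF DERIV_exp] DERIV_minus i)
      then show ?thesis
        using 1 by (simp add: flat_poly_def algebra_simps)
    qed
    moreover have "\<forall>\<^sub>F y in nhds x. y > 0"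
      using 1 by (rule eventually_nhds_in_open[OF open_greaterThan, simplified])
    ultimately show ?thesis
      by (subst DERIV_cong_ev[OF refl _ refl]) (auto elim!: eventually_mono simp: flat_poly_def)
  next
    case 2
    have "\<forall>\<^sub>F y in nhds x. y < 0"
      using 2 by (rule eventually_nhds_in_open[OF open_lessThan, simplified])
    then have "(flat_poly P has_real_derivative 0) (at x) = ((\<lambda>_. 0) has_real_derivative 0) (at x)"
      by (intro DERIV_cong_ev) (auto elim!: eventually_mono simp: flat_poly_def)
    then show ?thesis using 2 by (simp add: flat_poly_def)
  next
    case 3
    \<comment> \<open>This is the difference quotient at 0. On the right, y = 1 / t turns it into t
      P(t) exp (- t), where the exponential wins.\<close>
    have "((\<lambda>y. flat_poly P y / y) \<longlongrightarrow> 0) (at 0)"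
      unfolding filterlim_at_split
    proof
      have "\<forall>\<^sub>F y in at_left 0. flat_poly P y / y = 0"
        by (auto simp: eventually_at_filter flat_poly_def)
      then show "((\<lambda>y. flat_poly P y / y) \<longlongrightarrow> 0) (at_left 0)"
        by (rule tendsto_eventually)
      have "((\<lambda>y. poly ([:0, 1:] * P) (inverse y) * exp (- inverse y)) \<longlongrightarrow> 0) (at_right 0)"
        by (rule filterlim_compose[OF poly_times_exp_minus_tendsto_0 filterlim_inverse_at_top_right])
      then show "((\<lambda>y. flat_poly P y / y) \<longlongrightarrow> 0) (at_right 0)"
        by (rule Lim_transform_eventually)
          (auto simp: eventually_at_filter flat_poly_def field_simps)
    qed
    then show ?thesis
      using 3 by (simp add: has_field_derivative_iff flat_poly_def)
  qed
qed

lemma diff_class_flat_poly: "diff_class n (flat_poly P)"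
proof (induction n arbitrary: P)
  case (Suc n)
  show ?case by (rule diff_class_SucI[OF flat_poly_deriv Suc])
qed simp

section \<open>The du Bois-Reymond lemma\<close>

lemma continuous_has_antiderivative:
  fixes f :: "real \<Rightarrow> real"
  assumes "continuous_on UNIV f"
  obtains F where "\<And>x. (F has_real_derivative f x) (at x)"
proof -
  have "\<exists>F. \<forall>x::real. -\<infinity> < ereal x \<longrightarrow> ereal x < \<infinity> \<longrightarrow> (F has_vector_derivative f x) (at x)"
    using assms by (intro einterval_antiderivative) (auto simp: continuous_on_eq_continuous_at)
  then show ?thesis
    using that by (auto simp: has_real_derivative_iff_has_vector_derivative)
qed

lemma integrable_compact_support:
  fixes g :: "real \<Rightarrow> real"
  assumes "continuous_on UNIV g" and "\<And>x. x \<notin> {a..b} \<Longrightarrow> g x = 0"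
  shows "integrable lborel g"
proof -
  have "integrable lborel (\<lambda>x. g x * indicator {a..b} x)"
    using assms(1) by (intro borel_integrable_atLeastAtMost) (auto simp: continuous_on_eq_continuous_at)
  moreover have "(\<lambda>x. g x * indicator {a..b} x) = g"
    using assms(2) by (auto split: split_indicator)
  ultimately show ?thesis by simp
qed

lemma deriv_zero_off_support:
  fixes g :: "real \<Rightarrow> real"
  assumes "\<And>x. (g has_real_derivative g' x) (at x)" and "\<And>x. x \<notin> {a..b} \<Longrightarrow> g x = 0"
    and "x \<notin> {a..b}"
  shows "g' x = 0"
proof -
  have "\<forall>\<^sub>F y in nhds x. y \<in> - {a..b}"
    using assms(3) by (intro eventually_nhds_in_open) auto
  then have "(g has_real_derivative g' x) (at x) = ((\<lambda>_. 0) has_real_derivative g' x) (at x)"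
    using assms(2) by (intro DERIV_cong_ev) (auto elim!: eventually_mono)
  then have "((\<lambda>_. 0) has_real_derivative g' x) (at x)" using assms(1) by simp
  then show ?thesis using DERIV_unique DERIV_const by blast
qed

lemma integral_deriv_eq_increment:
  fixes g :: "real \<Rightarrow> real"
  assumes g: "\<And>x. (g has_real_derivative g' x) (at x)" and c: "continuous_on UNIV g'"
    and s: "\<And>x. x \<notin> {a..b} \<Longrightarrow> g' x = 0" and "a \<le> b"
  shows "(LINT x|lborel. g' x) = g b - g a"
proof -
  have "(LINT x|lborel. g' x) = (LINT x|lborel. g' x * indicator {a..b} x)"
    using s by (intro Bochner_Integration.integral_cong) (auto split: split_indicator)
  also have "\<dots> = g b - g a"
    using g c \<open>a \<le> b\<close> by (intro integral_FTC_Icc_real) (auto simp: continuous_on_eq_continuous_at)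
  finally show ?thesis .
qed

lemma integral_deriv_compact_support:
  fixes g :: "real \<Rightarrow> real"
  assumes g: "\<And>x. (g has_real_derivative g' x) (at x)" and c: "continuous_on UNIV g'"
    and s: "\<And>x. x \<notin> {a..b} \<Longrightarrow> g x = 0"
  shows "(LINT x|lborel. g' x) = 0"
proof -
  \<comment> \<open>The margin 1 puts both end points strictly outside \<open>{a..b}\<close>, where
    \<open>g\<close> vanishes; \<open>min\<close> and \<open>max\<close> cover the case a >
    b.\<close>
  define l r where "l = min a b - 1" and "r = max a b + 1"
  have "g' x = 0" if "x \<notin> {l..r}" for x
    using that by (intro deriv_zero_off_support[OF g s]) (auto simp: l_def r_def)
  then have "(LINT x|lborel. g' x) = g r - g l"
    by (intro integral_deriv_eq_increment[OF g c]) (auto simp: l_def r_def)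
  moreover have "g l = 0" "g r = 0"
    by (rule s; auto simp: l_def r_def)+
  ultimately show ?thesis by simp
qed

lemma test_funE:
  assumes "test_fun \<psi>"
  obtains a b where "\<And>x. (\<psi> has_real_derivative deriv \<psi> x) (at x)"
    "continuous_on UNIV \<psi>" "continuous_on UNIV (deriv \<psi>)"
    "\<And>x. x \<notin> {a..b} \<Longrightarrow> \<psi> x = 0" "\<And>x. x \<notin> {a..b} \<Longrightarrow> deriv \<psi> x = 0"
proof -
  have s: "\<And>n. diff_class n \<psi>"
    using assms by (auto simp: test_fun_def smooth_fun_iff_diff_class)
  have d: "(\<psi> has_real_derivative deriv \<psi> x) (at x)" for x
    by (rule diff_class_deriv(1)[OF s])
  have d2: "(deriv \<psi> has_real_derivative deriv (deriv \<psi>) x) (at x)" for x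
    by (intro diff_class_deriv s)
  obtain a b where ab: "\<And>x. x \<notin> {a..b} \<Longrightarrow> \<psi> x = 0"
    using assms by (auto simp: test_fun_def)
  have "continuous_on UNIV \<psi>" "continuous_on UNIV (deriv \<psi>)"
    using d d2 DERIV_isCont by (blast intro: continuous_at_imp_continuous_on)+
  then show ?thesis
    using that d ab deriv_zero_off_support[OF d ab] by blast
qed

lemma distr_deriv_zero_const: "distr_deriv_zero (\<lambda>_. K)"
  unfolding distr_deriv_zero_def
proof (intro allI impI)
  fix \<psi> assume "test_fun \<psi>"
  then obtain a b where t: "\<And>x. (\<psi> has_real_derivative deriv \<psi> x) (at x)"
    "continuous_on UNIV \<psi>" "continuous_on UNIV (deriv \<psi>)"
    "\<And>x. x \<notin> {a..b} \<Longrightarrow> \<psi> x = 0" "\<And>x. x \<notin> {a..b} \<Longrightarrow> deriv \<psi> x = 0"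
    using test_funE by blast
  show "(LINT x|lborel. K * deriv \<psi> x) = 0"
    using t(3,4) by (intro integral_deriv_compact_support[OF DERIV_cmult[OF t(1)], of K a b])
      (auto intro!: continuous_intros)
qed

text \<open>The classical derivative is a weak one: the product of \<open>f\<close> with a test
  function has compact support, so the integral of its derivative vanishes, which is integration by
  parts.\<close>

lemma H1_funI:
  assumes d: "\<And>x. (f has_real_derivative f' x) (at x)" and c: "continuous_on UNIV f'"
    and "integrable lborel (\<lambda>x. (f x)\<^sup>2)" "integrable lborel (\<lambda>x. (f' x)\<^sup>2)"
  shows "H1_fun f"
proof -
  have cf: "continuous_on UNIV f"
    using d DERIV_isCont by (blast intro: continuous_at_imp_continuous_on)
  have "L2_fun f" "L2_fun f'"
    using assms cf by (auto simp: L2_fun_def intro: borel_measurable_continuous_onI)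
  moreover have "(LINT x|lborel. f x * deriv \<psi> x) = - (LINT x|lborel. f' x * \<psi> x)"
    if "test_fun \<psi>" for \<psi>
  proof -
    obtain a b where t: "\<And>x. (\<psi> has_real_derivative deriv \<psi> x) (at x)"
      "continuous_on UNIV \<psi>" "continuous_on UNIV (deriv \<psi>)"
      "\<And>x. x \<notin> {a..b} \<Longrightarrow> \<psi> x = 0" "\<And>x. x \<notin> {a..b} \<Longrightarrow> deriv \<psi> x = 0"
      using test_funE[OF \<open>test_fun \<psi>\<close>] by blast
    have "(LINT x|lborel. f' x * \<psi> x + deriv \<psi> x * f x) = 0"
      using t by (intro integral_deriv_compact_support[OF DERIV_mult[OF d t(1)], of a b])
        (auto intro!: continuous_intros c cf)
    moreover have "integrable lborel (\<lambda>x. f' x * \<psi> x)" "integrable lborel (\<lambda>x. deriv \<psi> x * f x)"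
      using t by (intro integrable_compact_support[of _ a b]; auto intro!: continuous_intros c cf)+
    ultimately show ?thesis by (simp add: mult.commute)
  qed
  ultimately show ?thesis unfolding H1_fun_def by blast
qed

section \<open>Bumps as test functions\<close>

definition bump :: "real \<Rightarrow> real \<Rightarrow> real" where
  "bump d x = flat_poly 1 x * flat_poly 1 (d - x)"

lemma diff_class_bump: "diff_class n (bump d)"
  using diff_class_mult[OF diff_class_flat_poly diff_class_shift[OF diff_class_flat_poly, of _ _ "-1" d]]
  by (simp add: bump_def[abs_def])

lemma bump_nonneg: "bump d x \<ge> 0" and bump_pos: "0 < x \<Longrightarrow> x < d \<Longrightarrow> bump d x > 0"
  and bump_zero: "x \<notin> {0..d} \<Longrightarrow> bump d x = 0"
  by (auto simp: bump_def flat_poly_def)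

lemma continuous_on_bump: "continuous_on UNIV (bump d)"
proof -
  have "(bump d has_real_derivative deriv (bump d) x) (at x)" for x
    by (rule diff_class_deriv[OF diff_class_bump])
  then show ?thesis
    using DERIV_isCont by (blast intro: continuous_at_imp_continuous_on)
qed

text \<open>A primitive of a bump does not have compact support, but it is constant on either side
  of \<open>{0..d}\<close>. Two of its translates therefore differ only on a bounded
  interval.\<close>

lemma test_fun_bump_primitive_difference:
  assumes P: "\<And>x. (P has_real_derivative bump d x) (at x)" and "d > 0"
  shows "test_fun (\<lambda>x. P (x - a) - P (x - b))"
proof -
  have "diff_class n P" for n
    by (rule diff_class_SucD[OF diff_class_SucI[OF P diff_class_bump]])
  then have "diff_class n (\<lambda>x. P (x - a) - P (x - b))" for n
    using diff_class_diff[OF diff_class_shift[of n P 1 "-a"] diff_class_shift[of n P 1 "-b"]] by simp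
  then have "smooth_fun (\<lambda>x. P (x - a) - P (x - b))"
    by (simp add: smooth_fun_iff_diff_class)
  have l: "P x = P 0" if "x \<le> 0" for x
  proof (rule ccontr)
    assume "P x \<noteq> P 0"
    with that have "x < 0" by (cases "x = 0") auto
    from MVT2[OF this P] obtain z where "x < z" "z < 0" "P 0 - P x = (0 - x) * bump d z" by auto
    with bump_zero[of z d] \<open>P x \<noteq> P 0\<close> show False by auto
  qed
  have r: "P x = P d" if "x \<ge> d" for x
  proof (rule ccontr)
    assume "P x \<noteq> P d"
    with that have "d < x" by (cases "x = d") auto
    from MVT2[OF this P] obtain z where "d < z" "z < x" "P x - P d = (x - d) * bump d z" by auto
    with bump_zero[of z d] \<open>P x \<noteq> P d\<close> show False by auto
  qed
  have "P (x - a) - P (x - b) = 0" if "x \<notin> {min a b..max a b + d}" for x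
    using that l[of "x - a"] l[of "x - b"] r[of "x - a"] r[of "x - b"] by auto
  with \<open>smooth_fun _\<close> show ?thesis unfolding test_fun_def by blast
qed

text \<open>If \<open>W a < W b\<close>, then testing against the difference of the
  translates to \<open>a\<close> and \<open>b\<close> of the primitive of a narrow bump contradicts \<open>W' = 0\<close>.\<close>

lemma distr_deriv_zero_imp_le:
  assumes W: "distr_deriv_zero W" and c: "continuous_on UNIV W"
  shows "W b \<le> W a"
proof (rule ccontr)
  assume "\<not> W b \<le> W a"
  \<comment> \<open>Shifting both bumps back to \<open>{0..d}\<close> turns the test integral into
    minus the integral of \<open>V\<close> against one bump, so only \<open>V\<close> near 0
    matters.\<close>
  define V where "V x = W (x + b) - W (x + a)" for x
  have V0: "V 0 > 0" using \<open>\<not> _\<close> by (simp add: V_def)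
  have cV: "continuous_on UNIV V"
    unfolding V_def by (intro continuous_intros continuous_on_compose2[OF c]) auto
  define e where "e = V 0 / 2"
  have "isCont V 0" using cV by (simp add: continuous_on_eq_continuous_at)
  then obtain d0 where "d0 > 0" and d0: "\<And>x. dist x 0 < d0 \<Longrightarrow> dist (V x) (V 0) < e"
    unfolding continuous_at_eps_delta using V0 e_def by (metis half_gt_zero)
  define d where "d = d0 / 2"
  have "d > 0" using \<open>d0 > 0\<close> by (simp add: d_def)
  have Ve: "V x \<ge> e" if "x \<in> {0..d}" for x
  proof -
    have "dist x 0 < d0" using that \<open>d0 > 0\<close> by (auto simp: d_def dist_real_def)
    from d0[OF this] show ?thesis by (auto simp: dist_real_def e_def abs_if split: if_splits)
  qed
  obtain P where P: "\<And>x. (P has_real_derivative bump d x) (at x)"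
    using continuous_has_antiderivative[OF continuous_on_bump] by blast
  have I: "(LINT x|lborel. bump d x) = P d - P 0"
    using \<open>d > 0\<close> by (intro integral_deriv_eq_increment[OF P continuous_on_bump] bump_zero) auto
  have "P d > P 0"
  proof -
    from MVT2[OF \<open>d > 0\<close> P] obtain z where "0 < z" "z < d" "P d - P 0 = d * bump d z" by auto
    moreover have "d * bump d z > 0" using \<open>d > 0\<close> bump_pos calculation by (intro mult_pos_pos) auto
    ultimately show ?thesis by linarith
  qed
  have dP: "deriv (\<lambda>x. P (x - a) - P (x - b)) = (\<lambda>x. bump d (x - a) - bump d (x - b))"
  proof
    fix x
    have s: "((\<lambda>x. P (x - t)) has_real_derivative bump d (x - t)) (at x)" for t
      using DERIV_shift[of P "bump d (x - t)" x "- t"] P by simp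
    show "deriv (\<lambda>x. P (x - a) - P (x - b)) x = bump d (x - a) - bump d (x - b)"
      by (intro DERIV_imp_deriv DERIV_diff s)
  qed
  have int: "integrable lborel (\<lambda>x. W x * bump d (x - t))" for t
    by (intro integrable_compact_support[of _ t "t + d"] continuous_intros c
        continuous_on_compose2[OF continuous_on_bump]) (auto intro!: bump_zero)
  have int0: "integrable lborel (\<lambda>x. W (x + t) * bump d x)" for t
    by (intro integrable_compact_support[of _ 0 d] continuous_intros continuous_on_compose2[OF c]
        continuous_on_bump) (auto intro!: bump_zero)
  have sh: "(LINT x|lborel. W x * bump d (x - t)) = (LINT x|lborel. W (x + t) * bump d x)" for t
    by (subst lborel_integral_real_affine[of 1 _ t]) (auto simp: add.commute)
  have "0 = (LINT x|lborel. W x * (bump d (x - a) - bump d (x - b)))"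
    using W test_fun_bump_primitive_difference[OF P \<open>d > 0\<close>, of a b] dP
    unfolding distr_deriv_zero_def by metis
  also have "\<dots> = (LINT x|lborel. W x * bump d (x - a)) - (LINT x|lborel. W x * bump d (x - b))"
    using int by (simp add: right_diff_distrib)
  also have "\<dots> = (LINT x|lborel. W (x + a) * bump d x - W (x + b) * bump d x)"
    unfolding sh using int0 by simp
  also have "\<dots> = (LINT x|lborel. - (V x * bump d x))"
    by (simp add: V_def algebra_simps)
  finally have z: "(LINT x|lborel. V x * bump d x) = 0" by simp
  \<comment> \<open>The lower bound is \<open>e\<close> times the positive mass of the bump, whereas
    the right-hand integral has just been shown to vanish.\<close>
  have "(LINT x|lborel. e * bump d x) \<le> (LINT x|lborel. V x * bump d x)"
  proof (rule integral_mono)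
    show "integrable lborel (\<lambda>x. e * bump d x)" "integrable lborel (\<lambda>x. V x * bump d x)"
      by (intro integrable_compact_support[of _ 0 d] continuous_intros continuous_on_bump cV;
          simp add: bump_zero)+
    show "e * bump d x \<le> V x * bump d x" for x
      using Ve[of x] bump_zero[of x d] bump_nonneg[of d x]
      by (cases "x \<in> {0..d}") (auto intro: mult_right_mono)
  qed
  then have "e * (P d - P 0) \<le> 0" using z I by simp
  moreover have "e > 0" using V0 by (simp add: e_def)
  ultimately show False using \<open>P d > P 0\<close> by (simp add: mult_le_0_iff)
qed

lemma distr_deriv_zero_imp_const:
  assumes "distr_deriv_zero W" "continuous_on UNIV W"
  shows "W x = W y"
  using distr_deriv_zero_imp_le[OF assms] by (simp add: antisym)

section \<open>Convolution with the Green kernel\<close>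

lemma integrable_exp_minus_abs:
  fixes k :: real
  assumes "k > 0"
  shows "integrable lborel (\<lambda>x. exp (- (k * \<bar>x\<bar>)))"
proof -
  define g where "g x = indicator {0..} x *\<^sub>R exp (- k * x)" for x :: real
  have "set_integrable lebesgue {0..} (\<lambda>x. exp (- k * x))"
    using assms by (intro nonnegative_absolutely_integrable_1 integrable_on_exp_minus_to_infinity) auto
  then have g: "integrable lborel g"
    unfolding set_integrable_def g_def[abs_def] by (subst (asm) integrable_completion) auto
  then have "integrable lborel (\<lambda>x. g (0 + (-1) * x))"
    by (rule lborel_integrable_real_affine) simp
  \<comment> \<open>At x = 0 this sum is twice the target function, elsewhere it equals it; hence
    domination rather than equality in the next step.\<close>
  with g have "integrable lborel (\<lambda>x. g x + g (- x))" by simp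
  then show ?thesis
    by (rule Bochner_Integration.integrable_bound) (auto simp: g_def abs_if split: split_indicator)
qed

lemma integrable_pker: "integrable lborel pker"
  using integrable_exp_minus_abs[of 1] by (simp add: pker_def[abs_def])

lemma integrable_pker_mult:
  assumes c: "continuous_on UNIV F" and b: "\<And>y. \<bar>F y\<bar> \<le> M"
  shows "integrable lborel (\<lambda>y. pker (x - y) * F y)"
proof -
  have "integrable lborel (\<lambda>y. pker (x + (-1) * y))"
    by (rule lborel_integrable_real_affine[OF integrable_pker]) simp
  then have i: "integrable lborel (\<lambda>y. M * pker (x - y))" by simp
  have [measurable]: "F \<in> borel_measurable borel"
    using c by (rule borel_measurable_continuous_onI)
  show ?thesis
  proof (rule Bochner_Integration.integrable_bound[OF i])
    have [measurable]: "pker \<in> borel_measurable borel" unfolding pker_def by measurable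
    show "(\<lambda>y. pker (x - y) * F y) \<in> borel_measurable lborel" by measurable
    have "0 \<le> M" using b[of 0] by linarith
    then show "AE y in lborel. norm (pker (x - y) * F y) \<le> norm (M * pker (x - y))"
      using b by (intro AE_I2) (auto simp: abs_mult mult.commute pker_def intro!: mult_right_mono)
  qed
qed

text \<open>The part y \<le> x of the convolution with the kernel, after the factor exp (- x) / 2
  has been taken out, so that x survives only as the upper limit. The part y \<ge> x is the same
  integral for the reflected function.\<close>

definition half_exp_integral :: "(real \<Rightarrow> real) \<Rightarrow> real \<Rightarrow> real" where
  "half_exp_integral F x = (LINT y|lborel. indicator {..x} y * (exp y * F y))"

lemma integrable_half_exp:
  fixes F :: "real \<Rightarrow> real"
  assumes c: "continuous_on UNIV F" and b: "\<And>y. \<bar>F y\<bar> \<le> M"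
  shows "integrable lborel (\<lambda>y. indicator {..x} y * (exp y * F y))"
proof -
  have "integrable lborel (\<lambda>y. indicator {..x} y *\<^sub>R (2 * exp x * (pker (x - y) * F y)))"
    by (intro integrable_mult_indicator integrable_mult_right integrable_pker_mult[OF assms]) auto
  moreover have eq: "indicator {..x} y *\<^sub>R (2 * exp x * (pker (x - y) * F y))
      = indicator {..x} y * (exp y * F y)" for y :: real
    by (auto simp: pker_def exp_diff split: split_indicator)
  ultimately show ?thesis unfolding eq by blast
qed

lemma half_exp_integral_deriv:
  assumes c: "continuous_on UNIV F" and b: "\<And>y. \<bar>F y\<bar> \<le> M"
  shows "(half_exp_integral F has_real_derivative exp x * F x) (at x)"
proof -
  have cg: "continuous_on UNIV (\<lambda>y. exp y * F y)" by (intro continuous_intros c)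
  obtain G where G: "\<And>y. (G has_real_derivative exp y * F y) (at y)"
    using continuous_has_antiderivative[OF cg] by blast
  \<comment> \<open>A base point to the left of x, kept fixed while z varies near x: the integral up
    to z is then a constant plus an increment of \<open>G\<close>. The half-open
    \<open>{..<a}\<close> meets \<open>{a..z}\<close> nowhere, so the integrands add up
    pointwise.\<close>
  define a where "a = x - 1"
  have i0: "integrable lborel (\<lambda>y. indicator {..<a} y * (exp y * F y))"
  proof -
    have "integrable lborel (\<lambda>y. indicator {..<a} y *\<^sub>R (indicator {..a} y * (exp y * F y)))"
      by (intro integrable_mult_indicator integrable_half_exp[OF assms]) auto
    moreover have eq: "indicator {..<a} y *\<^sub>R (indicator {..a} y * (exp y * F y))
        = indicator {..<a} y * (exp y * F y)" for y
      by (auto split: split_indicator)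
    ultimately show ?thesis unfolding eq by blast
  qed
  define B where "B = (LINT y|lborel. indicator {..<a} y * (exp y * F y))"
  have "half_exp_integral F z = B + (G z - G a)" if "z > a" for z
  proof -
    have hb: "has_bochner_integral lborel (\<lambda>y. (exp y * F y) * indicator {a..z} y) (G z - G a)"
      using that G cg by (intro has_bochner_integral_FTC_Icc_real)
        (auto simp: continuous_on_eq_continuous_at)
    have "half_exp_integral F z =
        (LINT y|lborel. indicator {..<a} y * (exp y * F y) + (exp y * F y) * indicator {a..z} y)"
      unfolding half_exp_integral_def using that
      by (intro Bochner_Integration.integral_cong) (auto split: split_indicator)
    also have "\<dots> = B + (G z - G a)"
      using i0 hb by (simp add: B_def has_bochner_integral_iff)
    finally show ?thesis .
  qed
  moreover have "\<forall>\<^sub>F z in nhds x. z \<in> {a<..}"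
    by (intro eventually_nhds_in_open) (auto simp: a_def)
  ultimately have "\<forall>\<^sub>F z in nhds x. half_exp_integral F z = B + (G z - G a)"
    by (auto elim!: eventually_mono)
  moreover have "((\<lambda>z. B + (G z - G a)) has_real_derivative exp x * F x) (at x)"
    using G[of x] by (auto intro!: derivative_eq_intros)
  ultimately show ?thesis by (subst DERIV_cong_ev[OF refl _ refl])
qed

lemma pconv_split:
  assumes c: "continuous_on UNIV F" and b: "\<And>y. \<bar>F y\<bar> \<le> M"
  shows "pconv F x =
    (exp (- x) * half_exp_integral F x + exp x * half_exp_integral (\<lambda>y. F (- y)) (- x)) / 2"
proof -
  have c': "continuous_on UNIV (\<lambda>y. F (- y))"
    by (intro continuous_on_compose2[OF c] continuous_intros) auto
  note i1 = integrable_half_exp[OF c b, of x]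
  have i2': "integrable lborel (\<lambda>y. indicator {..- x} (0 + (-1) * y) * (exp (0 + (-1) * y) * F (- (0 + (-1) * y))))"
    by (rule lborel_integrable_real_affine[OF integrable_half_exp[OF c' b]]) simp
  have eq: "indicator {..- x} (0 + (-1) * y) * (exp (0 + (-1) * y) * F (- (0 + (-1) * y)))
      = indicator {x..} y * (exp (- y) * F y)" for y :: real
    by (auto split: split_indicator)
  have i2: "integrable lborel (\<lambda>y. indicator {x..} y * (exp (- y) * F y))"
    using i2' unfolding eq .
  have h2: "half_exp_integral (\<lambda>y. F (- y)) (- x) = (LINT y|lborel. indicator {x..} y * (exp (- y) * F y))"
    unfolding half_exp_integral_def
    by (subst lborel_integral_real_affine[of "-1" _ 0]) (simp_all only: eq, simp)
  have [measurable]: "F \<in> borel_measurable borel"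
    using c by (rule borel_measurable_continuous_onI)
  have [measurable]: "pker \<in> borel_measurable borel" unfolding pker_def by measurable
  have "pconv F x = (LINT y|lborel. (exp (- x) / 2) * (indicator {..x} y * (exp y * F y))
      + (exp x / 2) * (indicator {x..} y * (exp (- y) * F y)))"
    unfolding pconv_def
  proof (rule integral_cong_AE)
    \<comment> \<open>Both indicators equal 1 at y = x, so the integrands agree only off this
      point.\<close>
    show "AE y in lborel. pker (x - y) * F y = (exp (- x) / 2) * (indicator {..x} y * (exp y * F y))
      + (exp x / 2) * (indicator {x..} y * (exp (- y) * F y))"
      using AE_lborel_singleton[of x]
    proof eventually_elim
      case (elim y)
      then show ?case
        by (auto simp: pker_def exp_diff exp_minus field_simps split: split_indicator)
    qed
  qed measurable
  also have "\<dots> = (exp (- x) / 2) * half_exp_integral F x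
      + (exp x / 2) * half_exp_integral (\<lambda>y. F (- y)) (- x)"
    unfolding h2 using i1 i2 by (simp add: half_exp_integral_def)
  finally show ?thesis by (simp add: field_simps)
qed

text \<open>The kernel is the Green function of 1 - d^2/dx^2. With L' = exp x F and R' = - exp (- x)
  F, the terms in F cancel in the first derivative of the split form and add up to - F in the
  second.\<close>

lemma pconv_deriv2:
  assumes c: "continuous_on UNIV F" and b: "\<And>y. \<bar>F y\<bar> \<le> M"
  obtains u' where "\<And>x. (pconv F has_real_derivative u' x) (at x)"
    "\<And>x. (u' has_real_derivative pconv F x - F x) (at x)"
proof -
  define L R where "L = half_exp_integral F" and "R = (\<lambda>x. half_exp_integral (\<lambda>y. F (- y)) (- x))"
  have c': "continuous_on UNIV (\<lambda>y. F (- y))"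
    by (intro continuous_on_compose2[OF c] continuous_intros) auto
  have L: "(L has_real_derivative exp x * F x) (at x)" for x
    unfolding L_def by (rule half_exp_integral_deriv[OF c b])
  have R: "(R has_real_derivative - (exp (- x) * F x)) (at x)" for x
  proof -
    have "((\<lambda>x. half_exp_integral (\<lambda>y. F (- y)) (- x)) has_real_derivative
        (exp (- x) * F (- (- x))) * (- 1)) (at x)"
      by (rule DERIV_chain2[OF half_exp_integral_deriv[OF c' b]]) (auto intro!: derivative_eq_intros)
    then show ?thesis by (simp add: R_def)
  qed
  have u: "pconv F = (\<lambda>x. (exp (- x) * L x + exp x * R x) / 2)"
    unfolding L_def R_def using pconv_split[OF c b] by blast
  have e: "exp x * exp (- x) = 1" for x :: real by (simp add: exp_minus)
  have m: "((\<lambda>x. exp (- x)) has_real_derivative - exp (- x)) (at x)" for x :: real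
    by (auto intro!: derivative_eq_intros)
  have "(pconv F has_real_derivative (exp x * R x - exp (- x) * L x) / 2) (at x)" for x
    unfolding u
    by (rule DERIV_cong[OF DERIV_cdivide[OF DERIV_add[OF DERIV_mult[OF m L] DERIV_mult[OF DERIV_exp R]]]])
      (simp add: algebra_simps)
  moreover have "((\<lambda>x. (exp x * R x - exp (- x) * L x) / 2) has_real_derivative pconv F x - F x) (at x)" for x
  proof (rule DERIV_cong[OF DERIV_cdivide[OF DERIV_diff[OF DERIV_mult[OF DERIV_exp R] DERIV_mult[OF m L]]]])
    have "- (exp (- x) * F x) * exp x - exp x * F x * exp (- x) = - 2 * (exp x * exp (- x)) * F x"
      by (simp add: algebra_simps)
    then show "(exp x * R x + - (exp (- x) * F x) * exp x
        - (- exp (- x) * L x + exp x * F x * exp (- x))) / 2 = pconv F x - F x"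
      unfolding u e by (simp add: field_simps)
  qed
  ultimately show ?thesis by (rule that)
qed

section \<open>Limits of the convolution and uniqueness\<close>

lemma pconv_reflect_arg: "pconv F x = (LINT z|lborel. pker z * F (x - z))"
  unfolding pconv_def by (subst lborel_integral_real_affine[of "-1" _ x]) auto

text \<open>The normalisation of the kernel without computing its integral: by translation
  invariance the convolution is a constant I, and I'' = I - K forces I = K.\<close>

lemma pconv_const: "pconv (\<lambda>_. K) x = K"
proof -
  have "pconv (\<lambda>_. K) = (\<lambda>_. LINT z|lborel. pker z * K)"
    by (auto simp: pconv_reflect_arg)
  then obtain I where I: "pconv (\<lambda>_. K) = (\<lambda>_. I)" by blast
  obtain u' where u: "\<And>x. (pconv (\<lambda>_. K) has_real_derivative u' x) (at x)"
    "\<And>x. (u' has_real_derivative pconv (\<lambda>_. K) x - K) (at x)"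
    using pconv_deriv2[of "\<lambda>_. K" "\<bar>K\<bar>"] by auto
  have "u' = (\<lambda>_. 0)"
    using u(1) unfolding I using DERIV_unique DERIV_const by blast
  then have "pconv (\<lambda>_. K) x - K = 0"
    using u(2)[of x] DERIV_unique DERIV_const by blast
  then show ?thesis by simp
qed

text \<open>Dominated convergence with majorant \<open>M * pker z\<close>; the limit integral is the
  convolution of the constant K, which is known.\<close>

lemma pconv_tendsto_at_top:
  assumes c: "continuous_on UNIV F" and b: "\<And>y. \<bar>F y\<bar> \<le> M" and l: "(F \<longlongrightarrow> K) at_top"
  shows "(pconv F \<longlongrightarrow> K) at_top"
proof -
  have [measurable]: "F \<in> borel_measurable borel"
    using c by (rule borel_measurable_continuous_onI)
  have [measurable]: "pker \<in> borel_measurable borel" unfolding pker_def by measurable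
  have "0 \<le> M" using b[of 0] by linarith
  have "((\<lambda>x. LINT z|lborel. pker z * F (x - z)) \<longlongrightarrow> (LINT z|lborel. pker z * K)) at_top"
  proof (rule integral_dominated_convergence_at_top[where w = "\<lambda>z. M * pker z"])
    show "integrable lborel (\<lambda>z. M * pker z)" using integrable_pker by simp
    show "AE z in lborel. ((\<lambda>x. pker z * F (x - z)) \<longlongrightarrow> pker z * K) at_top"
    proof (intro AE_I2 tendsto_intros)
      fix z :: real
      have "filterlim (\<lambda>x. - z + x) at_top at_top"
        by (rule filterlim_tendsto_add_at_top[OF tendsto_const filterlim_ident])
      from filterlim_compose[OF l this] show "((\<lambda>x. F (x - z)) \<longlongrightarrow> K) at_top" by simp
    qed
    show "\<forall>\<^sub>F x in at_top. AE z in lborel. norm (pker z * F (x - z)) \<le> M * pker z"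
      using b by (intro always_eventually allI AE_I2)
        (auto simp: abs_mult mult.commute pker_def intro!: mult_right_mono)
  qed measurable
  then show ?thesis
    using pconv_const[of K 0] unfolding pconv_reflect_arg[symmetric]
    unfolding pconv_reflect_arg[of "\<lambda>_. K"] by auto
qed

lemma pconv_reflect: "pconv (\<lambda>y. F (- y)) x = pconv F (- x)"
  unfolding pconv_def
  by (subst lborel_integral_real_affine[of "-1" _ 0]) (auto simp: pker_def abs_minus_commute intro!: Bochner_Integration.integral_cong)

lemma pconv_tendsto_at_bot:
  assumes c: "continuous_on UNIV F" and b: "\<And>y. \<bar>F y\<bar> \<le> M" and l: "(F \<longlongrightarrow> K) at_bot"
  shows "(pconv F \<longlongrightarrow> K) at_bot"
proof -
  have "continuous_on UNIV (\<lambda>y. F (- y))"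
    by (intro continuous_on_compose2[OF c] continuous_intros) auto
  then have "(pconv (\<lambda>y. F (- y)) \<longlongrightarrow> K) at_top"
    using b l by (intro pconv_tendsto_at_top) (auto simp: filterlim_at_bot_mirror)
  then show ?thesis
    unfolding filterlim_at_bot_mirror pconv_reflect[of F, symmetric] by simp
qed

text \<open>Both \<open>(w' + w) exp (- x)\<close> and \<open>(w' - w) exp x\<close> are constant.\<close>

lemma decaying_solution_zero:
  fixes w :: "real \<Rightarrow> real"
  assumes w: "\<And>x. (w has_real_derivative w' x) (at x)" "\<And>x. (w' has_real_derivative w x) (at x)"
    and l: "(w \<longlongrightarrow> 0) at_top" "(w \<longlongrightarrow> 0) at_bot"
  shows "w x = 0"
proof -
  define C D where "C = w' 0 + w 0" and "D = w' 0 - w 0"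
  have "((\<lambda>x. (w' x + w x) * exp (- x)) has_real_derivative 0) (at x)" for x
    by (auto intro!: derivative_eq_intros w simp: algebra_simps)
  then have C: "(w' x + w x) * exp (- x) = C" for x
    using DERIV_isconst_all[of "\<lambda>x. (w' x + w x) * exp (- x)" x 0] by (simp add: C_def)
  have "((\<lambda>x. (w' x - w x) * exp x) has_real_derivative 0) (at x)" for x
    by (auto intro!: derivative_eq_intros w simp: algebra_simps)
  then have D: "(w' x - w x) * exp x = D" for x
    using DERIV_isconst_all[of "\<lambda>x. (w' x - w x) * exp x" x 0] by (simp add: D_def)
  have eq: "w x = (C * exp x - D * exp (- x)) / 2" for x
  proof -
    have "w' x + w x = C * exp x" "w' x - w x = D * exp (- x)"
      using C[of x] D[of x] by (auto simp: exp_minus field_simps)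
    then show ?thesis by argo
  qed
  have top0: "((\<lambda>x::real. exp (- x)) \<longlongrightarrow> 0) at_top"
    using filterlim_compose[OF exp_at_bot filterlim_uminus_at_bot_at_top] by simp
  have bot0: "((\<lambda>x::real. exp x) \<longlongrightarrow> 0) at_bot" by (rule exp_at_bot)
  \<comment> \<open>Solving the formula for \<open>w\<close> for C leaves only terms that vanish at
    infinity; the same at minus infinity disposes of D.\<close>
  have "((\<lambda>x. 2 * w x * exp (- x) + D * exp (- x) * exp (- x)) \<longlongrightarrow> 2 * 0 * 0 + D * 0 * 0) at_top"
    by (intro tendsto_intros l top0)
  moreover have "2 * w x * exp (- x) + D * exp (- x) * exp (- x) = C" for x
    unfolding eq by (simp add: exp_minus field_simps)
  ultimately have "C = 0" by (simp add: tendsto_const_iff)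
  have "((\<lambda>x. C * exp x * exp x - 2 * w x * exp x) \<longlongrightarrow> C * 0 * 0 - 2 * 0 * 0) at_bot"
    by (intro tendsto_intros l bot0)
  moreover have "C * exp x * exp x - 2 * w x * exp x = D" for x
    unfolding eq by (simp add: exp_minus field_simps)
  ultimately have "D = 0" by (simp add: tendsto_const_iff)
  with \<open>C = 0\<close> show ?thesis by (simp add: eq)
qed

text \<open>The difference of the two functions solves w'' = w and decays, hence is zero. This
  verifies the convolution equation for an explicit profile without evaluating the integral.\<close>

lemma pconv_eqI:
  assumes v: "\<And>x. (v has_real_derivative v' x) (at x)" "\<And>x. (v' has_real_derivative v x - F x) (at x)"
    and c: "continuous_on UNIV F" and b: "\<And>y. \<bar>F y\<bar> \<le> M"
    and lF: "(F \<longlongrightarrow> K) at_top" "(F \<longlongrightarrow> K) at_bot"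
    and lv: "(v \<longlongrightarrow> K) at_top" "(v \<longlongrightarrow> K) at_bot"
  shows "pconv F x = v x"
proof -
  obtain u' where u: "\<And>x. (pconv F has_real_derivative u' x) (at x)"
    "\<And>x. (u' has_real_derivative pconv F x - F x) (at x)"
    using pconv_deriv2[OF c b] by blast
  have "pconv F x - v x = 0"
  proof (rule decaying_solution_zero[where w = "\<lambda>x. pconv F x - v x" and w' = "\<lambda>x. u' x - v' x"])
    show "((\<lambda>x. pconv F x - v x) has_real_derivative u' x - v' x) (at x)" for x
      by (intro DERIV_diff u v)
    show "((\<lambda>x. u' x - v' x) has_real_derivative pconv F x - v x) (at x)" for x
      using DERIV_diff[OF u(2) v(2), of x] by simp
    show "((\<lambda>x. pconv F x - v x) \<longlongrightarrow> 0) at_top"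
      using tendsto_diff[OF pconv_tendsto_at_top[OF c b lF(1)] lv(1)] by simp
    show "((\<lambda>x. pconv F x - v x) \<longlongrightarrow> 0) at_bot"
      using tendsto_diff[OF pconv_tendsto_at_bot[OF c b lF(2)] lv(2)] by simp
  qed
  then show ?thesis by simp
qed

section \<open>Solitary waves are smooth and fast\<close>

lemma continuous_limits_imp_bounded:
  fixes f :: "real \<Rightarrow> real"
  assumes c: "continuous_on UNIV f" and l: "(f \<longlongrightarrow> K) at_top" "(f \<longlongrightarrow> K) at_bot"
  obtains M where "\<And>x. \<bar>f x\<bar> \<le> M"
proof -
  have "\<forall>\<^sub>F x in at_top. \<bar>f x - K\<bar> < 1" "\<forall>\<^sub>F x in at_bot. \<bar>f x - K\<bar> < 1"
    using l tendstoD[of f K _ 1] by (auto simp: dist_real_def)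
  then obtain a b where ab: "\<And>x. x \<ge> b \<Longrightarrow> \<bar>f x - K\<bar> < 1" "\<And>x. x \<le> a \<Longrightarrow> \<bar>f x - K\<bar> < 1"
    by (auto simp: eventually_at_top_linorder eventually_at_bot_linorder)
  have "compact (f ` {a..b})"
    by (intro compact_continuous_image continuous_on_subset[OF c]) auto
  then obtain M where M: "\<And>x. x \<in> {a..b} \<Longrightarrow> \<bar>f x\<bar> \<le> M"
    using compact_imp_bounded by (fastforce simp: bounded_iff)
  have "\<bar>f x\<bar> \<le> max M (\<bar>K\<bar> + 1)" for x
    using ab(1)[of x] ab(2)[of x] M[of x] by (cases "x \<in> {a..b}") auto
  then show ?thesis by (rule that)
qed

definition wave_source :: "real \<Rightarrow> (real \<Rightarrow> real) \<Rightarrow> (real \<Rightarrow> real) \<Rightarrow> real \<Rightarrow> real" where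
  "wave_source A \<phi> \<eta> y = - A * \<phi> y + 3/2 * (\<phi> y)\<^sup>2 + 1/2 * (1 + \<eta> y)\<^sup>2"

lemma wave_source_tendsto:
  assumes "(\<phi> \<longlongrightarrow> 0) F" "(\<eta> \<longlongrightarrow> 0) F"
  shows "(wave_source A \<phi> \<eta> \<longlongrightarrow> 1/2) F"
proof -
  have "((\<lambda>y. - A * \<phi> y + 3/2 * (\<phi> y)\<^sup>2 + 1/2 * (1 + \<eta> y)\<^sup>2) \<longlongrightarrow>
      - A * 0 + 3/2 * 0\<^sup>2 + 1/2 * (1 + 0)\<^sup>2) F"
    by (intro tendsto_intros assms)
  then show ?thesis by (simp add: wave_source_def[abs_def])
qed

lemma continuous_on_wave_source:
  "continuous_on S \<phi> \<Longrightarrow> continuous_on S \<eta> \<Longrightarrow> continuous_on S (wave_source A \<phi> \<eta>)"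
  unfolding wave_source_def by (intro continuous_intros)

text \<open>The constants of integration are read off from the limits at infinity.\<close>

lemma solitary_wave_integrated:
  assumes "solitary_wave A c \<phi> \<eta>"
  shows "(1 + \<eta> x) * \<phi> x = c * \<eta> x"
    and "pconv (wave_source A \<phi> \<eta>) x = c * \<phi> x + 1/2"
    and "\<exists>\<phi>1. \<forall>x. ((\<lambda>x. c * \<phi> x) has_real_derivative \<phi>1 x) (at x) \<and>
          (\<phi>1 has_real_derivative c * \<phi> x + 1/2 - wave_source A \<phi> \<eta> x) (at x)"
proof -
  let ?F = "wave_source A \<phi> \<eta>"
  have cont: "continuous_on UNIV \<phi>" "continuous_on UNIV \<eta>"
    and lim: "(\<phi> \<longlongrightarrow> 0) at_top" "(\<phi> \<longlongrightarrow> 0) at_bot" "(\<eta> \<longlongrightarrow> 0) at_top" "(\<eta> \<longlongrightarrow> 0) at_bot"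
    and eq1: "distr_deriv_zero (\<lambda>x. - c * \<phi> x + pconv ?F x)"
    and eq2: "distr_deriv_zero (\<lambda>x. - c * \<eta> x + (1 + \<eta> x) * \<phi> x)"
    using assms unfolding solitary_wave_def wave_source_def[abs_def] by auto
  have cF: "continuous_on UNIV ?F" by (intro continuous_on_wave_source cont)
  obtain M where M: "\<And>x. \<bar>?F x\<bar> \<le> M"
    using continuous_limits_imp_bounded[OF cF wave_source_tendsto wave_source_tendsto] lim by metis
  obtain u' where u: "\<And>x. (pconv ?F has_real_derivative u' x) (at x)"
    "\<And>x. (u' has_real_derivative pconv ?F x - ?F x) (at x)"
    using pconv_deriv2[OF cF M] by blast
  have cu: "continuous_on UNIV (pconv ?F)"
    using u(1) DERIV_isCont by (blast intro: continuous_at_imp_continuous_on)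
  define W V where "W = (\<lambda>x. - c * \<phi> x + pconv ?F x)" and "V = (\<lambda>x. - c * \<eta> x + (1 + \<eta> x) * \<phi> x)"
  have W_const: "W = (\<lambda>_. W 0)"
    using eq1 unfolding W_def[symmetric]
    by (intro ext distr_deriv_zero_imp_const) (auto simp: W_def intro!: continuous_intros cu cont)
  moreover have "(W \<longlongrightarrow> - c * 0 + 1/2) at_top"
    unfolding W_def by (intro tendsto_intros lim pconv_tendsto_at_top[OF cF M] wave_source_tendsto)
  ultimately have "W 0 = 1/2" by (metis add_0 mult_zero_right tendsto_const_iff trivial_limit_at_top_linorder)
  with W_const have Wx: "W x = 1/2" for x by metis
  show eq: "pconv ?F x = c * \<phi> x + 1/2" for x
    using Wx[of x] by (simp add: W_def)
  have V_const: "V = (\<lambda>_. V 0)"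
    using eq2 unfolding V_def[symmetric]
    by (intro ext distr_deriv_zero_imp_const) (auto simp: V_def intro!: continuous_intros cont)
  moreover have "(V \<longlongrightarrow> - c * 0 + (1 + 0) * 0) at_top"
    unfolding V_def by (intro tendsto_intros lim)
  ultimately have "V 0 = 0" by (metis add_0 mult_zero_right tendsto_const_iff trivial_limit_at_top_linorder)
  with V_const have "V x = 0" by metis
  then show "(1 + \<eta> x) * \<phi> x = c * \<eta> x" by (simp add: V_def)
  \<comment> \<open>\<open>c * \<phi> x\<close> differs from the convolution by a constant and
    inherits its two derivatives. Keeping the factor c leaves the statement usable for c =
    0.\<close>
  have "((\<lambda>x. c * \<phi> x) has_real_derivative u' x) (at x)" for x
    using DERIV_diff[OF u(1)[of x] DERIV_const[of "1/2"]] by (simp add: eq)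
  then show "\<exists>\<phi>1. \<forall>x. ((\<lambda>x. c * \<phi> x) has_real_derivative \<phi>1 x) (at x) \<and>
          (\<phi>1 has_real_derivative c * \<phi> x + 1/2 - wave_source A \<phi> \<eta> x) (at x)"
    using u(2) unfolding eq by blast
qed

text \<open>The range is an interval and contains points closer to 0 than v. Contraposed, a value
  that is never attained acts as a barrier for a decaying function.\<close>

lemma takes_value_between:
  fixes f :: "real \<Rightarrow> real"
  assumes c: "continuous_on UNIV f" and l: "(f \<longlongrightarrow> 0) at_top" and "f x < v \<and> v < 0 \<or> 0 < v \<and> v < f x"
  obtains y where "f y = v"
proof -
  have conn: "connected (range f)" using c by (intro connected_continuous_image) auto
  have "\<forall>\<^sub>F y in at_top. \<bar>f y\<bar> < \<bar>v\<bar>"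
    using tendstoD[OF l, of "\<bar>v\<bar>"] assms(3) by (auto simp: dist_real_def)
  then obtain z where "\<bar>f z\<bar> < \<bar>v\<bar>" by (meson eventually_at_top_linorder order_refl)
  then have "f x \<le> v \<and> v \<le> f z \<or> f z \<le> v \<and> v \<le> f x" using assms(3) by auto
  then have "v \<in> range f" using connectedD_interval[OF conn] by blast
  then show ?thesis using that by auto
qed

section \<open>Zero speed\<close>

lemma no_solitary_wave_zero_speed: "\<not> solitary_wave A 0 \<phi> \<eta>"
proof
  assume sw: "solitary_wave A 0 \<phi> \<eta>"
  have cont: "continuous_on UNIV \<phi>" "continuous_on UNIV \<eta>"
    and lim: "(\<phi> \<longlongrightarrow> 0) at_top" "(\<eta> \<longlongrightarrow> 0) at_top"
    and nz: "\<exists>x. \<phi> x \<noteq> 0 \<or> \<eta> x \<noteq> 0"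
    using sw unfolding solitary_wave_def by auto
  have e2: "(1 + \<eta> x) * \<phi> x = 0" for x using solitary_wave_integrated(1)[OF sw] by simp
  have e1: "wave_source A \<phi> \<eta> x = 1/2" for x
  proof -
    obtain u where u: "\<And>x. ((\<lambda>x. 0 * \<phi> x) has_real_derivative u x) (at x)"
      "\<And>x. (u has_real_derivative 0 * \<phi> x + 1/2 - wave_source A \<phi> \<eta> x) (at x)"
      using solitary_wave_integrated(3)[OF sw] by blast
    have "u = (\<lambda>_. 0)"
    proof
      fix x show "u x = 0" using DERIV_unique[OF u(1)[of x, simplified] DERIV_const] .
    qed
    then show ?thesis using DERIV_unique[OF u(2)[of x, unfolded \<open>u = _\<close>] DERIV_const] by simp
  qed
  \<comment> \<open>Where \<open>\<phi>\<close> is nonzero, \<open>e2\<close> gives \<eta> = - 1,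
    and \<open>e1\<close> becomes this quadratic equation. A nonzero value of \<open>\<phi>\<close>
    would force all values between it and 0 into this finite set.\<close>
  define B where "B = {v::real. 3 * (v * v) = 2 * A * v + 1}"
  have B: "\<phi> x = 0 \<or> \<phi> x \<in> B" for x
    using e1[of x] e2[of x] by (auto simp: B_def wave_source_def power2_eq_square)
  have "finite B"
  proof -
    have "B \<subseteq> {x. poly [:- 1, - 2 * A, 3:] x = 0}" by (auto simp: B_def algebra_simps)
    then show ?thesis using poly_roots_finite[of "[:- 1, - 2 * A, 3:]"] finite_subset by fastforce
  qed
  have phi0: "\<phi> x = 0" for x
  proof (rule ccontr)
    assume "\<phi> x \<noteq> 0"
    then have "infinite {min 0 (\<phi> x)<..<max 0 (\<phi> x)}" by (simp add: infinite_Ioo)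
    moreover have "{min 0 (\<phi> x)<..<max 0 (\<phi> x)} \<subseteq> B"
    proof
      fix v assume v: "v \<in> {min 0 (\<phi> x)<..<max 0 (\<phi> x)}"
      then have "\<phi> x < v \<and> v < 0 \<or> 0 < v \<and> v < \<phi> x" by (auto simp: min_def max_def split: if_splits)
      then obtain y where "\<phi> y = v" using takes_value_between[OF cont(1) lim(1)] by blast
      then show "v \<in> B" using B[of y] v by auto
    qed
    ultimately show False using \<open>finite B\<close> finite_subset by blast
  qed
  have eta: "\<eta> x = 0 \<or> \<eta> x = - 2" for x
  proof -
    have "\<eta> x * (\<eta> x + 2) = 0"
      using e1[of x] phi0[of x] by (simp add: wave_source_def power2_eq_square algebra_simps)
    then show ?thesis by auto
  qed
  have "\<eta> x = 0" for x
  proof (rule ccontr)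
    assume "\<eta> x \<noteq> 0"
    \<comment> \<open>A passage from - 2 to 0 must cross - 1, which is not among the two admissible
      values.\<close>
    then obtain y where "\<eta> y = - 1"
      using eta[of x] takes_value_between[OF cont(2) lim(2), of x "-1"] by auto
    then show False using eta[of y] by auto
  qed
  with phi0 nz show False by simp
qed

section \<open>Positive speed: the reduced equation and its regularity\<close>

lemma solitary_wave_positive_speed:
  assumes sw: "solitary_wave A c \<phi> \<eta>" and "c > 0"
  obtains \<phi>' where "\<And>x. \<phi> x < c" "\<And>x. \<eta> x = \<phi> x * inverse (c - \<phi> x)"
    "\<And>x. (\<phi> has_real_derivative \<phi>' x) (at x)"
    "\<And>x. (\<phi>' has_real_derivative (c * \<phi> x + 1/2 - wave_source A \<phi> \<eta> x) * inverse c) (at x)"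
proof -
  have cont: "continuous_on UNIV \<phi>" and lim: "(\<phi> \<longlongrightarrow> 0) at_top"
    using sw unfolding solitary_wave_def by auto
  note e = solitary_wave_integrated(1)[OF sw]
  \<comment> \<open>At a point with \<phi> = c the relation \<open>e\<close> would read 1 + \<eta> =
    \<eta>. So c is a barrier, and decay to 0 keeps \<open>\<phi>\<close> below it.\<close>
  have ne: "\<phi> x \<noteq> c" for x using e[of x] \<open>c > 0\<close> by (auto simp: algebra_simps)
  have lt: "\<phi> x < c" for x
  proof (rule ccontr)
    assume "\<not> \<phi> x < c"
    then have "c < \<phi> x" using ne[of x] by simp
    then obtain y where "\<phi> y = c" using takes_value_between[OF cont lim, of x c] \<open>c > 0\<close> by auto
    with ne show False by blast
  qed
  have eta: "\<eta> x = \<phi> x * inverse (c - \<phi> x)" for x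
    using e[of x] lt[of x] by (simp add: field_simps)
  obtain u where u: "\<And>x. ((\<lambda>x. c * \<phi> x) has_real_derivative u x) (at x)"
    "\<And>x. (u has_real_derivative c * \<phi> x + 1/2 - wave_source A \<phi> \<eta> x) (at x)"
    using solitary_wave_integrated(3)[OF sw] by blast
  have "(\<phi> has_real_derivative u x * inverse c) (at x)" for x
  proof -
    have "(\<lambda>x. c * \<phi> x * inverse c) = \<phi>" using \<open>c > 0\<close> by auto
    then show ?thesis using DERIV_cmult_right[OF u(1)[of x], of "inverse c"] by simp
  qed
  moreover have "((\<lambda>x. u x * inverse c) has_real_derivative
      (c * \<phi> x + 1/2 - wave_source A \<phi> \<eta> x) * inverse c) (at x)" for x
    by (rule DERIV_cmult_right[OF u(2)])
  ultimately show ?thesis by (rule that[OF lt eta])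
qed

text \<open>Bootstrap: if \<open>\<phi>\<close> is in class n, so is \<open>\<eta>\<close>, a
  rational function of it without poles, and hence \<phi>''. Then \<phi>' is in class n too, which
  lifts \<open>\<phi>\<close> to class n + 1.\<close>

lemma solitary_wave_smooth_positive_speed:
  assumes sw: "solitary_wave A c \<phi> \<eta>" and "c > 0"
  shows "smooth_fun \<phi> \<and> smooth_fun \<eta>"
proof -
  obtain \<phi>' where s: "\<And>x. \<phi> x < c" "\<And>x. \<eta> x = \<phi> x * inverse (c - \<phi> x)"
    "\<And>x. (\<phi> has_real_derivative \<phi>' x) (at x)"
    "\<And>x. (\<phi>' has_real_derivative (c * \<phi> x + 1/2 - wave_source A \<phi> \<eta> x) * inverse c) (at x)"
    using solitary_wave_positive_speed[OF assms] by blast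
  have ne: "c - \<phi> x \<noteq> 0" for x using s(1)[of x] by simp
  have eta: "diff_class n \<eta>" if "diff_class n \<phi>" for n
  proof -
    have "diff_class n (\<lambda>x. \<phi> x * inverse (c - \<phi> x))"
      by (intro diff_class_mult diff_class_inverse[OF diff_class_diff] diff_class_const that ne)
    then show ?thesis by (simp add: s(2)[abs_def, symmetric])
  qed
  have phi: "diff_class n \<phi>" for n
  proof (induction n)
    case (Suc n)
    have "diff_class n (\<lambda>x. (c * \<phi> x + 1/2 - wave_source A \<phi> \<eta> x) * inverse c)"
      unfolding wave_source_def power2_eq_square
      by (intro diff_class_mult diff_class_diff diff_class_add diff_class_const Suc eta[OF Suc])
    then have "diff_class n \<phi>'" by (rule diff_class_SucD[OF diff_class_SucI[OF s(4)]])
    then show ?case by (rule diff_class_SucI[OF s(3)])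
  qed simp
  then show ?thesis using eta by (simp add: smooth_fun_iff_diff_class)
qed

section \<open>The first integral and the speed bound\<close>

lemma solitary_wave_energy:
  assumes sw: "solitary_wave A c \<phi> \<eta>" and "c > 0"
  shows "\<phi> x < c" and "(\<phi> x)\<^sup>2 * ((c - \<phi> x) * (c + A - \<phi> x) - 1) \<ge> 0"
    and "(\<phi> x)\<^sup>2 * ((c - \<phi> x) * (c + A - \<phi> x) - 1) = 0 \<longleftrightarrow> deriv \<phi> x = 0"
proof -
  obtain \<phi>' where s: "\<And>x. \<phi> x < c" "\<And>x. \<eta> x = \<phi> x * inverse (c - \<phi> x)"
    "\<And>x. (\<phi> has_real_derivative \<phi>' x) (at x)"
    "\<And>x. (\<phi>' has_real_derivative (c * \<phi> x + 1/2 - wave_source A \<phi> \<eta> x) * inverse c) (at x)"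
    using solitary_wave_positive_speed[OF assms] by blast
  have lim: "(\<phi> \<longlongrightarrow> 0) at_top" using sw unfolding solitary_wave_def by auto
  \<comment> \<open>\<open>P\<close> is the primitive, zero at 0, of twice the expression for c
    \<phi>'' as a function of v = \<phi>, with \<eta> = v / (c - v) inserted. Hence \<open>E\<close>
    is conserved.\<close>
  define P where "P v = (c + A) * v\<^sup>2 - v ^ 3 - v\<^sup>2 / (c - v)" for v
  define E where "E x = c * (\<phi>' x)\<^sup>2 - P (\<phi> x)" for x
  have dE: "(E has_real_derivative 0) (at x)" for x
  proof -
    have ne: "c - \<phi> x \<noteq> 0" using s(1)[of x] by simp
    have eta: "2 * \<eta> x + (\<eta> x)\<^sup>2 = (2 * \<phi> x * (c - \<phi> x) + (\<phi> x)\<^sup>2) / (c - \<phi> x)\<^sup>2"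
      using ne by (simp add: s(2) divide_simps) (simp add: algebra_simps power2_eq_square)
    have "(E has_real_derivative c * (2 * \<phi>' x * ((c * \<phi> x + 1/2 - wave_source A \<phi> \<eta> x) * inverse c))
       - ((c + A) * (2 * \<phi> x * \<phi>' x) - 3 * (\<phi> x)\<^sup>2 * \<phi>' x
        - (2 * \<phi> x * (c - \<phi> x) + (\<phi> x)\<^sup>2) / (c - \<phi> x)\<^sup>2 * \<phi>' x)) (at x)"
      unfolding E_def P_def using ne
      by (auto intro!: derivative_eq_intros s(3,4) simp: power2_eq_square algebra_simps)
    moreover have "c * (2 * \<phi>' x * ((c * \<phi> x + 1/2 - wave_source A \<phi> \<eta> x) * inverse c))
       = 2 * \<phi>' x * (c * \<phi> x + 1/2 - wave_source A \<phi> \<eta> x)" using \<open>c > 0\<close> by simp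
    ultimately show ?thesis
      unfolding eta[symmetric] wave_source_def by (simp add: algebra_simps power2_eq_square)
  qed
  have E: "E x = E 0" for x by (rule DERIV_isconst_all) (use dE in blast)
  have Plim: "((\<lambda>x. P (\<phi> (f x))) \<longlongrightarrow> 0) at_top" if "filterlim f at_top at_top" for f
  proof -
    have l: "((\<lambda>x. \<phi> (f x)) \<longlongrightarrow> 0) at_top" by (rule filterlim_compose[OF lim that])
    have "((\<lambda>x. P (\<phi> (f x))) \<longlongrightarrow> (c + A) * 0\<^sup>2 - 0 ^ 3 - 0\<^sup>2 / (c - 0)) at_top"
      unfolding P_def using \<open>c > 0\<close> by (intro tendsto_intros l) auto
    then show ?thesis by simp
  qed
  \<comment> \<open>Decay of \<phi>' is not yet known, so the energy is evaluated along points
    \<open>z x\<close>, supplied by the mean value theorem, where \<phi>' is an increment of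
    \<open>\<phi>\<close> and tends to 0.\<close>
  have "\<exists>z. x < z \<and> z < x + 1 \<and> \<phi> (x + 1) - \<phi> x = \<phi>' z" for x
    using MVT2[of x "x + 1" \<phi> \<phi>'] s(3) by auto
  then obtain z where z: "\<And>x. x < z x" "\<And>x. \<phi> (x + 1) - \<phi> x = \<phi>' (z x)" by metis
  have fz: "filterlim z at_top at_top"
    using z(1) by (intro filterlim_at_top_mono[OF filterlim_ident]) (auto intro: always_eventually less_imp_le)
  have f1: "filterlim (\<lambda>x::real. x + 1) at_top at_top"
    using filterlim_tendsto_add_at_top[OF tendsto_const[of 1] filterlim_ident] by (simp add: add.commute)
  have "((\<lambda>x. c * (\<phi> (x + 1) - \<phi> x)\<^sup>2 - P (\<phi> (z x))) \<longlongrightarrow> c * (0 - 0)\<^sup>2 - 0) at_top"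
    by (intro tendsto_intros lim filterlim_compose[OF lim f1] Plim fz)
  moreover have "c * (\<phi> (x + 1) - \<phi> x)\<^sup>2 - P (\<phi> (z x)) = E 0" for x
    unfolding z(2) using E[of "z x"] by (simp add: E_def)
  ultimately have "E 0 = 0" by (simp add: tendsto_const_iff)
  then have "c * (\<phi>' x)\<^sup>2 = P (\<phi> x)" for x using E[of x] by (simp add: E_def)
  \<comment> \<open>The positive factor c - \<phi> clears the denominator of \<open>P\<close> and
    preserves signs and zeros.\<close>
  then have "c * (\<phi>' x)\<^sup>2 * (c - \<phi> x) = P (\<phi> x) * (c - \<phi> x)" for x by simp
  moreover have "P v * (c - v) = v\<^sup>2 * ((c - v) * (c + A - v) - 1)" if "v < c" for v
    using that by (simp add: P_def field_simps power2_eq_square power3_eq_cube)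
  ultimately have eq: "(\<phi> x)\<^sup>2 * ((c - \<phi> x) * (c + A - \<phi> x) - 1) = c * (\<phi>' x)\<^sup>2 * (c - \<phi> x)" for x
    using s(1) by metis
  show "\<phi> x < c" by (rule s)
  show "(\<phi> x)\<^sup>2 * ((c - \<phi> x) * (c + A - \<phi> x) - 1) \<ge> 0"
    unfolding eq using s(1)[of x] \<open>c > 0\<close> by simp
  have "deriv \<phi> x = \<phi>' x" by (rule DERIV_imp_deriv[OF s(3)])
  then show "(\<phi> x)\<^sup>2 * ((c - \<phi> x) * (c + A - \<phi> x) - 1) = 0 \<longleftrightarrow> deriv \<phi> x = 0"
    unfolding eq using s(1)[of x] \<open>c > 0\<close> by simp
qed

text \<open>If c \<le> \<open>A1\<close>, nonnegativity of the first integral allows only values 0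
  or at most \<open>c - A1\<close>, so \<open>\<phi>\<close> is negative somewhere. For c <
  \<open>A1\<close> the return to 0 must cross the forbidden gap; for c = \<open>A1\<close> the
  negative minimum would be a critical point, where the first integral has no admissible
  root.\<close>

lemma solitary_wave_speed_bound:
  assumes sw: "solitary_wave A c \<phi> \<eta>" and "c > 0"
  shows "c > (- A + sqrt (A\<^sup>2 + 4)) / 2"
proof (rule ccontr)
  define A1 A2 where "A1 = (- A + sqrt (A\<^sup>2 + 4)) / 2" and "A2 = (- A - sqrt (A\<^sup>2 + 4)) / 2"
  assume "\<not> ?thesis"
  then have "c \<le> A1" by (simp add: A1_def)
  have sq: "sqrt (A\<^sup>2 + 4) * sqrt (A\<^sup>2 + 4) = A * A + 4" by (simp add: power2_eq_square)
  have "\<bar>A\<bar> < sqrt (A\<^sup>2 + 4)" by (rule real_less_rsqrt) (simp add: power2_eq_square)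
  then have "A2 < 0" by (auto simp: A2_def)
  \<comment> \<open>\<open>A1\<close> and \<open>A2\<close> are the roots of w^2 + A w - 1, taken
    here at w = c - v.\<close>
  have fac: "(c - v) * (c + A - v) - 1 = (c - v - A1) * (c - v - A2)" for v
    using sq by (simp add: A1_def A2_def field_simps)
  have cont: "continuous_on UNIV \<phi>" and lim: "(\<phi> \<longlongrightarrow> 0) at_top" "(\<phi> \<longlongrightarrow> 0) at_bot"
    and nz: "\<exists>x. \<phi> x \<noteq> 0 \<or> \<eta> x \<noteq> 0"
    using sw unfolding solitary_wave_def by auto
  note en = solitary_wave_energy[OF assms, unfolded fac]
  have le: "\<phi> x \<le> c - A1" if "\<phi> x \<noteq> 0" for x
  proof -
    have "c - \<phi> x - A2 > 0" using en(1)[of x] \<open>A2 < 0\<close> by linarith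
    then show ?thesis using en(2)[of x] that by (auto simp: zero_le_mult_iff)
  qed
  \<comment> \<open>If \<open>\<phi>\<close> vanished identically, c \<eta> = (1 + \<eta>) \<phi>
    would make \<open>\<eta>\<close> vanish as well.\<close>
  obtain x0 where "\<phi> x0 \<noteq> 0"
    using nz solitary_wave_integrated(1)[OF sw] \<open>c > 0\<close> by force
  then have "\<phi> x0 < 0" using le[of x0] \<open>c \<le> A1\<close> by linarith
  show False
  proof (cases "c = A1")
    case False
    \<comment> \<open>Halving keeps both numbers negative and moves them up, so their maximum lies
      in the gap and above \<open>\<phi> x0\<close>.\<close>
    define v where "v = max (\<phi> x0 / 2) ((c - A1) / 2)"
    have "\<phi> x0 < v" "v < 0" "v > c - A1"
      using \<open>\<phi> x0 < 0\<close> False \<open>c \<le> A1\<close> by (auto simp: v_def less_max_iff_disj)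
    then obtain y where "\<phi> y = v" using takes_value_between[OF cont lim(1), of x0 v] by auto
    with le[of y] \<open>v < 0\<close> \<open>v > c - A1\<close> show False by simp
  next
    case True
    \<comment> \<open>Far out \<open>\<phi>\<close> exceeds \<open>\<phi> x0\<close>, so its minimum
      over a compact interval is global.\<close>
    have "\<forall>\<^sub>F x in at_top. \<phi> x > \<phi> x0" "\<forall>\<^sub>F x in at_bot. \<phi> x > \<phi> x0"
      using lim \<open>\<phi> x0 < 0\<close> by (auto intro: order_tendstoD)
    then obtain a b where ab: "\<And>x. x \<ge> b \<Longrightarrow> \<phi> x > \<phi> x0" "\<And>x. x \<le> a \<Longrightarrow> \<phi> x > \<phi> x0"
      by (auto simp: eventually_at_top_linorder eventually_at_bot_linorder)
    then have "x0 \<in> {a..b}" by (meson atLeastAtMost_iff less_irrefl linear)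
    then obtain xm where xm: "xm \<in> {a..b}" "\<And>x. x \<in> {a..b} \<Longrightarrow> \<phi> xm \<le> \<phi> x"
      using continuous_attains_inf[of "{a..b}" \<phi>] continuous_on_subset[OF cont] by (metis compact_Icc empty_iff subset_UNIV)
    have "\<phi> xm \<le> \<phi> x0" using xm \<open>x0 \<in> _\<close> by blast
    have min: "\<phi> xm \<le> \<phi> x" for x
      using ab(1)[of x] ab(2)[of x] xm(2)[of x] \<open>\<phi> xm \<le> \<phi> x0\<close> by (cases "x \<in> {a..b}") auto
    obtain D where D: "(\<phi> has_real_derivative D) (at xm)"
      using solitary_wave_positive_speed[OF assms] by metis
    have "D = 0" using DERIV_local_min[OF D, of 1] min by auto
    then have "deriv \<phi> xm = 0" using D DERIV_imp_deriv by blast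
    then have "\<phi> xm = 0 \<or> c - \<phi> xm - A1 = 0 \<or> c - \<phi> xm - A2 = 0" using en(3)[of xm] by auto
    then show False
      using \<open>\<phi> xm \<le> \<phi> x0\<close> \<open>\<phi> x0 < 0\<close> True en(1)[of xm] \<open>A2 < 0\<close> by auto
  qed
qed

section \<open>Construction of solitary waves\<close>

text \<open>Separation of variables: the solution is the inverse of a primitive of \<open>1 / h\<close>.\<close>

lemma autonomous_ode_solution:
  fixes h :: "real \<Rightarrow> real"
  assumes c: "continuous_on UNIV h" and "0 < l" and h: "\<And>t. l \<le> h t" "\<And>t. h t \<le> u"
  obtains \<theta> where "\<And>x. (\<theta> has_real_derivative h (\<theta> x)) (at x)" "\<And>x. l * \<bar>x\<bar> \<le> \<bar>\<theta> x\<bar>"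
proof -
  have pos: "h t > 0" for t using h(1)[of t] \<open>0 < l\<close> by linarith
  have "0 < u" using pos[of 0] h(2)[of 0] by linarith
  have "continuous_on UNIV (\<lambda>t. 1 / h t)"
    using pos by (intro continuous_intros c) (auto simp: less_imp_neq[symmetric])
  then obtain Y where Y: "\<And>t. (Y has_real_derivative 1 / h t) (at t)"
    using continuous_has_antiderivative by blast
  define X where "X t = Y t - Y 0" for t
  have X: "(X has_real_derivative 1 / h t) (at t)" for t
    unfolding X_def using DERIV_diff[OF Y DERIV_const[of "Y 0"]] by simp
  \<comment> \<open>The derivative of \<open>X\<close> lies between 1/u and 1/l. This makes
    \<open>X\<close> onto, its inverse Lipschitz with constant u, and gives the linear growth of the
    inverse.\<close>
  have inc: "(t - s) / u \<le> X t - X s \<and> X t - X s \<le> (t - s) / l" if "s < t" for s t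
  proof -
    obtain z where "X t - X s = (t - s) * (1 / h z)" using MVT2[OF \<open>s < t\<close> X] by blast
    then show ?thesis using that h[of z] pos[of z] \<open>0 < l\<close> by (auto intro!: divide_left_mono)
  qed
  have lip: "\<bar>t - s\<bar> \<le> u * \<bar>X t - X s\<bar>" "l * \<bar>X t - X s\<bar> \<le> \<bar>t - s\<bar>" for s t
  proof -
    have "\<bar>t - s\<bar> \<le> u * \<bar>X t - X s\<bar> \<and> l * \<bar>X t - X s\<bar> \<le> \<bar>t - s\<bar>" if "s < t" for s t
    proof -
      have "0 \<le> (t - s) / u" using that \<open>0 < u\<close> by simp
      then have "X t - X s \<ge> 0" using inc[OF that] by linarith
      then show ?thesis using inc[OF that] that \<open>0 < u\<close> \<open>0 < l\<close> by (auto simp: field_simps)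
    qed
    from this[of s t] this[of t s] show "\<bar>t - s\<bar> \<le> u * \<bar>X t - X s\<bar>" "l * \<bar>X t - X s\<bar> \<le> \<bar>t - s\<bar>"
      by (cases s t rule: linorder_cases; simp add: abs_minus_commute)+
  qed
  have X0: "X 0 = 0" by (simp add: X_def)
  have cX: "isCont X t" for t using X DERIV_isCont by blast
  have "\<exists>t. X t = y" for y
  proof -
    \<comment> \<open>Chosen so that T / u > \<bar>y\<bar>, whence \<open>inc\<close> places y
      between \<open>X (- T)\<close> and \<open>X T\<close>.\<close>
    define T where "T = u * \<bar>y\<bar> + 1"
    have "0 < T" using \<open>0 < u\<close> by (simp add: T_def add_nonneg_pos)
    have "T / u > \<bar>y\<bar>" using \<open>0 < u\<close> by (simp add: T_def field_simps)
    then have "X (- T) \<le> y" "y \<le> X T"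
      using inc[of 0 T] inc[of "- T" 0] \<open>0 < T\<close> X0 by auto
    then show ?thesis using IVT[of X "- T" y T] cX \<open>0 < T\<close> by auto
  qed
  then obtain \<theta> where \<theta>: "\<And>y. X (\<theta> y) = y" by metis
  have "isCont \<theta> x" for x
    unfolding continuous_at_eps_delta
  proof (intro allI impI)
    fix e :: real assume "e > 0"
    have "\<forall>y. dist y x < e / u \<longrightarrow> dist (\<theta> y) (\<theta> x) < e"
    proof (intro allI impI)
      fix y assume "dist y x < e / u"
      then have "u * \<bar>y - x\<bar> < e" using \<open>0 < u\<close> by (simp add: dist_real_def field_simps)
      with lip(1)[of "\<theta> y" "\<theta> x"] show "dist (\<theta> y) (\<theta> x) < e" by (simp add: \<theta> dist_real_def)
    qed
    then show "\<exists>d>0. \<forall>y. dist y x < d \<longrightarrow> dist (\<theta> y) (\<theta> x) < e"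
      using \<open>e > 0\<close> \<open>0 < u\<close> by (meson divide_pos_pos)
  qed
  then have "(\<theta> has_real_derivative inverse (1 / h (\<theta> x))) (at x)" for x
    using pos[of "\<theta> x"] \<theta> by (intro DERIV_inverse_function[OF X, where a = "x - 1" and b = "x + 1"]) auto
  moreover have "l * \<bar>x\<bar> \<le> \<bar>\<theta> x\<bar>" for x
    using lip(2)[of "\<theta> x" 0] by (simp add: \<theta> X0)
  ultimately show ?thesis by (intro that) auto
qed

text \<open>The expression equals 1 / cosh^2. The exponential bound, from cosh t \<ge> exp
  \<bar>t\<bar> / 2, is what later makes the wave decay.\<close>

lemma one_minus_tanh_square_bounds:
  fixes t :: real
  shows "0 < 1 - (tanh t)\<^sup>2" "1 - (tanh t)\<^sup>2 \<le> 1" "1 - (tanh t)\<^sup>2 \<le> 4 * exp (- (2 * \<bar>t\<bar>))"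
proof -
  have e: "1 - (tanh t)\<^sup>2 = 1 / (cosh t)\<^sup>2"
  proof -
    have "(cosh t)\<^sup>2 \<noteq> 0" by simp
    then have "1 - (tanh t)\<^sup>2 = ((cosh t)\<^sup>2 - (sinh t)\<^sup>2) / (cosh t)\<^sup>2"
      by (simp add: tanh_def power_divide diff_divide_distrib)
    then show ?thesis by (simp add: hyperbolic_pythagoras)
  qed
  show "0 < 1 - (tanh t)\<^sup>2" unfolding e by simp
  show "1 - (tanh t)\<^sup>2 \<le> 1" by simp
  have "exp \<bar>t\<bar> / 2 \<le> cosh t" by (cases "t \<ge> 0") (auto simp: cosh_def)
  then have "(exp \<bar>t\<bar> / 2)\<^sup>2 \<le> (cosh t)\<^sup>2" by (intro power_mono) auto
  then have "1 / (cosh t)\<^sup>2 \<le> 1 / (exp \<bar>t\<bar> / 2)\<^sup>2" by (intro divide_left_mono) auto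
  also have "\<dots> = 4 * exp (- (2 * \<bar>t\<bar>))"
    by (simp add: power2_eq_square exp_minus field_simps flip: exp_add)
  finally show "1 - (tanh t)\<^sup>2 \<le> 4 * exp (- (2 * \<bar>t\<bar>))" unfolding e .
qed

text \<open>The substitution \<open>\<phi> = m (1 - tanh\<^sup>2 \<theta>)\<close> desingularises
  \<open>\<phi>'\<^sup>2 = \<phi>\<^sup>2 (m - \<phi>) (n - \<phi>) / (c (c - \<phi>))\<close> at its turning point \<open>\<phi> = m\<close>: it becomes
  \<open>\<theta>' = h \<theta>\<close> with \<open>h\<^sup>2 = m (n - \<phi>) / (4 c (c - \<phi>))\<close> bounded away from zero.\<close>

lemma solitary_profile:
  fixes c m n :: real
  assumes "0 < m" "m < c" "c < n" and mn: "(c - m) * (n - c) = 1"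
  obtains \<phi> \<phi>' k C where "\<And>x. 0 < \<phi> x" "\<And>x. \<phi> x \<le> m"
    "\<And>x. (\<phi> has_real_derivative \<phi>' x) (at x)"
    "\<And>x. (\<phi>' has_real_derivative \<phi> x -
        (- (m + n - 2 * c) * \<phi> x + 3/2 * (\<phi> x)\<^sup>2 + \<phi> x / (c - \<phi> x) + (\<phi> x / (c - \<phi> x))\<^sup>2 / 2) / c) (at x)"
    "0 < k" "\<And>x. \<phi> x \<le> 4 * m * exp (- (k * \<bar>x\<bar>))" "\<And>x. \<bar>\<phi>' x\<bar> \<le> C * \<phi> x"
proof -
  have "0 < c" using assms by linarith
  define S where "S t = m * (1 - (tanh t)\<^sup>2)" for t :: real
  define H where "H v = m * (n - v) / (4 * c * (c - v))" for v
  define h where "h t = sqrt (H (S t))" for t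
  have S: "0 < S t" "S t \<le> m" for t
    unfolding S_def using one_minus_tanh_square_bounds[of t] \<open>0 < m\<close> by (auto simp: mult_le_cancel_left1)
  \<comment> \<open>The lower bound uses n > c, so that (n - v) / (c - v) is at least 1; the upper
    one takes v = 0 in the numerator and v = m in the denominator.\<close>
  have Hb: "m / (4 * c) \<le> H v" "H v \<le> m * n / (4 * c * (c - m))" if "0 < v" "v \<le> m" for v
  proof -
    have "m * (c - v) / (4 * c * (c - v)) \<le> H v"
      unfolding H_def using that assms \<open>0 < c\<close> by (intro divide_right_mono mult_left_mono) auto
    then show "m / (4 * c) \<le> H v" using that assms by simp
    show "H v \<le> m * n / (4 * c * (c - m))"
      unfolding H_def using that assms \<open>0 < c\<close> by (intro frac_le mult_left_mono mult_pos_pos) auto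
  qed
  define l u where "l = sqrt (m / (4 * c))" and "u = sqrt (m * n / (4 * c * (c - m)))"
  have "0 < l" using assms by (simp add: l_def)
  have hb: "l \<le> h t" "h t \<le> u" for t
    unfolding l_def u_def h_def using Hb[OF S] by (auto intro: real_sqrt_le_mono)
  have hpos: "0 < h t" for t using hb(1)[of t] \<open>0 < l\<close> by linarith
  have Hpos: "0 < H (S t)" for t using hpos[of t] by (simp add: h_def)
  have h2: "(h t)\<^sup>2 = H (S t)" for t using Hpos[of t] by (simp add: h_def)
  have dS: "(S has_real_derivative - 2 * S t * tanh t) (at t)" for t
    unfolding S_def by (auto intro!: derivative_eq_intros simp: power2_eq_square algebra_simps)
  have dH: "(H has_real_derivative m * (n - c) / (4 * c * (c - v)\<^sup>2)) (at v)" if "v \<le> m" for v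
  proof -
    have "c - v \<noteq> 0" "c \<noteq> 0" using that assms by auto
    then show ?thesis
      unfolding H_def
      by (auto intro!: derivative_eq_intros simp: divide_simps)
        (simp add: algebra_simps power2_eq_square)?
  qed
  have dh: "(h has_real_derivative
      m * (n - c) / (4 * c * (c - S t)\<^sup>2) * (- 2 * S t * tanh t) / (2 * h t)) (at t)" for t
  proof -
    have "((\<lambda>t. H (S t)) has_real_derivative m * (n - c) / (4 * c * (c - S t)\<^sup>2) * (- 2 * S t * tanh t)) (at t)"
      by (rule DERIV_chain2[OF dH[OF S(2)] dS])
    from DERIV_chain2[OF DERIV_real_sqrt[OF Hpos] this]
    have "(h has_real_derivative inverse (h t) / 2 *
        (m * (n - c) / (4 * c * (c - S t)\<^sup>2) * (- 2 * S t * tanh t))) (at t)"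
      unfolding h_def[abs_def] .
    then show ?thesis by (rule DERIV_cong) (use hpos[of t] in \<open>simp add: field_simps\<close>)
  qed
  have ch: "continuous_on UNIV h"
    using dh DERIV_isCont by (blast intro: continuous_at_imp_continuous_on)
  obtain \<theta> where \<theta>: "\<And>x. (\<theta> has_real_derivative h (\<theta> x)) (at x)" "\<And>x. l * \<bar>x\<bar> \<le> \<bar>\<theta> x\<bar>"
    using autonomous_ode_solution[OF ch \<open>0 < l\<close> hb] by blast
  define \<phi> where "\<phi> x = S (\<theta> x)" for x
  define \<phi>' where "\<phi>' x = - 2 * \<phi> x * tanh (\<theta> x) * h (\<theta> x)" for x
  have d1: "(\<phi> has_real_derivative \<phi>' x) (at x)" for x
    unfolding \<phi>_def \<phi>'_def by (rule DERIV_chain2[OF dS \<theta>(1)])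
  have d2: "(\<phi>' has_real_derivative \<phi> x -
        (- (m + n - 2 * c) * \<phi> x + 3/2 * (\<phi> x)\<^sup>2 + \<phi> x / (c - \<phi> x) + (\<phi> x / (c - \<phi> x))\<^sup>2 / 2) / c) (at x)" for x
  proof -
    define T v where "T = tanh (\<theta> x)" and "v = \<phi> x"
    have v: "v \<le> m" "c - v \<noteq> 0" "0 < v" unfolding v_def \<phi>_def using S[of "\<theta> x"] assms by auto
    have T2: "T\<^sup>2 = (m - v) / m"
      using \<open>0 < m\<close> by (simp add: T_def v_def \<phi>_def S_def field_simps)
    have hh: "(h (\<theta> x))\<^sup>2 = m * (n - v) / (4 * c * (c - v))"
      unfolding h2 by (simp add: H_def v_def \<phi>_def)
    have dT: "((\<lambda>x. tanh (\<theta> x)) has_real_derivative (1 - T\<^sup>2) * h (\<theta> x)) (at x)"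
      unfolding T_def by (rule DERIV_chain2[OF _ \<theta>(1)]) (auto intro!: derivative_eq_intros)
    have dhx: "((\<lambda>x. h (\<theta> x)) has_real_derivative
        m * (n - c) / (4 * c * (c - v)\<^sup>2) * (- 2 * v * T) / (2 * h (\<theta> x)) * h (\<theta> x)) (at x)"
      unfolding T_def v_def \<phi>_def by (rule DERIV_chain2[OF dh \<theta>(1)])
    have "(\<phi>' has_real_derivative
        (- 2 * \<phi>' x * T + (1 - T\<^sup>2) * h (\<theta> x) * (- 2 * v)) * h (\<theta> x) +
        m * (n - c) / (4 * c * (c - v)\<^sup>2) * (- 2 * v * T) / (2 * h (\<theta> x)) * h (\<theta> x) * (- 2 * v * T)) (at x)"
      unfolding \<phi>'_def[abs_def] unfolding T_def v_def
      by (rule DERIV_mult[OF DERIV_mult[OF DERIV_cmult[OF d1[unfolded \<phi>'_def]] dT[unfolded T_def]] dhx[unfolded T_def v_def]])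
    \<comment> \<open>Only even powers of T and h survive in \<phi>''. Since T^2 and h^2 are
      rational in v, what remains is an identity of rational functions.\<close>
    moreover have "(- 2 * \<phi>' x * T + (1 - T\<^sup>2) * h (\<theta> x) * (- 2 * v)) * h (\<theta> x) +
        m * (n - c) / (4 * c * (c - v)\<^sup>2) * (- 2 * v * T) / (2 * h (\<theta> x)) * h (\<theta> x) * (- 2 * v * T)
      = 4 * v * T\<^sup>2 * (h (\<theta> x))\<^sup>2 - 2 * v * (1 - T\<^sup>2) * (h (\<theta> x))\<^sup>2
        + m * (n - c) / (4 * c * (c - v)\<^sup>2) * (2 * v\<^sup>2 * T\<^sup>2)"
    proof -
      have G: "G * (- 2 * v * T) / (2 * h (\<theta> x)) * h (\<theta> x) = - G * v * T" for G
        using hpos[of "\<theta> x"] by simp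
      have p: "\<phi>' x = - 2 * v * T * h (\<theta> x)" by (simp add: \<phi>'_def T_def v_def)
      have "(- 2 * (- 2 * v * T * k) * T + (1 - T\<^sup>2) * k * (- 2 * v)) * k + - G * v * T * (- 2 * v * T)
        = 4 * v * T\<^sup>2 * k\<^sup>2 - 2 * v * (1 - T\<^sup>2) * k\<^sup>2 + G * (2 * v\<^sup>2 * T\<^sup>2)" for k G
        by algebra
      then show ?thesis unfolding G p .
    qed
    moreover have "\<dots> = v - (- (m + n - 2 * c) * v + 3/2 * v\<^sup>2 + v / (c - v) + (v / (c - v))\<^sup>2 / 2) / c"
    proof -
      have "4 * v * T\<^sup>2 * (h (\<theta> x))\<^sup>2 - 2 * v * (1 - T\<^sup>2) * (h (\<theta> x))\<^sup>2
        + m * (n - c) / (4 * c * (c - v)\<^sup>2) * (2 * v\<^sup>2 * T\<^sup>2)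
        = v * (2 * (m - v) * (n - v) * (c - v) - v * (n - v) * (c - v) + v * (m - v) * (n - c)) / (2 * c * (c - v)\<^sup>2)"
        unfolding T2 hh using \<open>0 < m\<close> v \<open>0 < c\<close>
        by (simp add: divide_simps) (simp add: algebra_simps power2_eq_square)
      \<comment> \<open>The relation \<open>mn\<close> enters here: it produces the terms - 2 (c -
        v) - v, which are the contribution of \<eta> = v / (c - v).\<close>
      also have "2 * (m - v) * (n - v) * (c - v) - v * (n - v) * (c - v) + v * (m - v) * (n - c)
        = 2 * c * (c - v)\<^sup>2 + 2 * (m + n - 2 * c) * (c - v)\<^sup>2 - 3 * v * (c - v)\<^sup>2 - 2 * (c - v) - v"
        using mn by algebra
      also have "v * (2 * c * (c - v)\<^sup>2 + 2 * (m + n - 2 * c) * (c - v)\<^sup>2 - 3 * v * (c - v)\<^sup>2 - 2 * (c - v) - v) / (2 * c * (c - v)\<^sup>2)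
        = v - (- (m + n - 2 * c) * v + 3/2 * v\<^sup>2 + v / (c - v) + (v / (c - v))\<^sup>2 / 2) / c"
        using v \<open>0 < c\<close>
        by (simp add: divide_simps) (simp add: algebra_simps power2_eq_square)
      finally show ?thesis .
    qed
    ultimately show ?thesis by (simp add: v_def)
  qed
  have dec: "\<phi> x \<le> 4 * m * exp (- (2 * l * \<bar>x\<bar>))" for x
  proof -
    have "\<phi> x \<le> m * (4 * exp (- (2 * \<bar>\<theta> x\<bar>)))"
      unfolding \<phi>_def S_def using one_minus_tanh_square_bounds(3) \<open>0 < m\<close> by (intro mult_left_mono) auto
    also have "\<dots> \<le> m * (4 * exp (- (2 * l * \<bar>x\<bar>)))"
      using \<theta>(2)[of x] \<open>0 < m\<close> by (intro mult_left_mono) auto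
    finally show ?thesis by simp
  qed
  \<comment> \<open>With this bound \<phi>' inherits the exponential decay of
    \<open>\<phi>\<close>.\<close>
  have bd: "\<bar>\<phi>' x\<bar> \<le> 2 * u * \<phi> x" for x
  proof -
    have "\<bar>tanh (\<theta> x)\<bar> \<le> 1" using one_minus_tanh_square_bounds(1)[of "\<theta> x"] abs_square_less_1[of "tanh (\<theta> x)"] by simp
    then have "\<bar>tanh (\<theta> x)\<bar> * h (\<theta> x) \<le> 1 * u"
      using hb(2) hpos[of "\<theta> x"] by (intro mult_mono) auto
    then have "2 * \<phi> x * (\<bar>tanh (\<theta> x)\<bar> * h (\<theta> x)) \<le> 2 * \<phi> x * u"
      using S(1)[of "\<theta> x"] by (intro mult_left_mono) (auto simp: \<phi>_def)
    then show ?thesis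
      using S(1)[of "\<theta> x"] hpos[of "\<theta> x"] by (simp add: \<phi>'_def abs_mult \<phi>_def mult_ac)
  qed
  show ?thesis
    by (rule that[of \<phi> \<phi>' "2 * l" "2 * u"]) (use S d1 d2 dec bd \<open>0 < l\<close> in \<open>auto simp: \<phi>_def\<close>)
qed

section \<open>From the profile to a solitary wave\<close>

lemma tendsto_0_of_exp_bound:
  fixes f :: "real \<Rightarrow> real"
  assumes "0 < k" and b: "\<And>x. \<bar>f x\<bar> \<le> C * exp (- (k * \<bar>x\<bar>))"
  shows "(f \<longlongrightarrow> 0) at_top" "(f \<longlongrightarrow> 0) at_bot"
proof -
  have *: "((\<lambda>x. g x) \<longlongrightarrow> 0) at_top" if g: "\<And>x. \<bar>g x\<bar> \<le> C * exp (- (k * \<bar>x\<bar>))" for g :: "real \<Rightarrow> real"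
  proof (rule Lim_null_comparison)
    show "\<forall>\<^sub>F x in at_top. norm (g x) \<le> C * exp (- (k * x))"
      using eventually_ge_at_top[of 0] 
    proof eventually_elim
      case (elim x)
      then show ?case using g[of x] by simp
    qed
    have "filterlim (\<lambda>x. - (k * x)) at_bot at_top"
      using \<open>0 < k\<close> by (simp add: filterlim_uminus_at_bot filterlim_tendsto_pos_mult_at_top[OF tendsto_const _ filterlim_ident])
    then have "((\<lambda>x. exp (- (k * x))) \<longlongrightarrow> 0) at_top"
      by (rule filterlim_compose[OF exp_at_bot])
    then show "((\<lambda>x. C * exp (- (k * x))) \<longlongrightarrow> 0) at_top"
      using tendsto_mult_right_zero by blast
  qed
  show "(f \<longlongrightarrow> 0) at_top" using b by (rule *)
  show "(f \<longlongrightarrow> 0) at_bot"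
    unfolding filterlim_at_bot_mirror using b[of "- _"] by (intro *) simp
qed

lemma integrable_square_of_exp_bound:
  fixes f :: "real \<Rightarrow> real"
  assumes "0 < k" and b: "\<And>x. \<bar>f x\<bar> \<le> C * exp (- (k * \<bar>x\<bar>))" and c: "continuous_on UNIV f"
  shows "integrable lborel (\<lambda>x. (f x)\<^sup>2)"
proof -
  have i: "integrable lborel (\<lambda>x. C\<^sup>2 * exp (- ((2 * k) * \<bar>x\<bar>)))"
    using \<open>0 < k\<close> by (intro integrable_mult_right integrable_exp_minus_abs) simp
  have "(f x)\<^sup>2 \<le> C\<^sup>2 * exp (- ((2 * k) * \<bar>x\<bar>))" for x
  proof -
    have "\<bar>f x\<bar>\<^sup>2 \<le> (C * exp (- (k * \<bar>x\<bar>)))\<^sup>2" using b by (intro power_mono) auto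
    also have "\<dots> = C\<^sup>2 * exp (- ((2 * k) * \<bar>x\<bar>))"
      by (simp add: power_mult_distrib flip: exp_double)
    finally show ?thesis by simp
  qed
  moreover have "f \<in> borel_measurable borel" using c by (rule borel_measurable_continuous_onI)
  ultimately show ?thesis
    by (intro Bochner_Integration.integrable_bound[OF i]) auto
qed

text \<open>The profile is completed by \<eta> = \<phi> / (c - \<phi>), as the second equation
  dictates. Exponential bounds on both functions and their derivatives give the limits and
  membership in H^1.\<close>

lemma solitary_wave_exists_positive_speed:
  assumes "c > 0" and "c > (- A + sqrt (A\<^sup>2 + 4)) / 2"
  shows "\<exists>\<phi> \<eta>. solitary_wave A c \<phi> \<eta>"
proof -
  define A1 A2 where "A1 = (- A + sqrt (A\<^sup>2 + 4)) / 2" and "A2 = (- A - sqrt (A\<^sup>2 + 4)) / 2"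
  have sq: "sqrt (A\<^sup>2 + 4) * sqrt (A\<^sup>2 + 4) = A * A + 4" by (simp add: power2_eq_square)
  have "\<bar>A\<bar> < sqrt (A\<^sup>2 + 4)" by (rule real_less_rsqrt) (simp add: power2_eq_square)
  then have "A2 < 0" "0 < A1" by (auto simp: A2_def A1_def)
  \<comment> \<open>The nonzero roots of the first integral. Here \<open>0 < m\<close> is the speed
    condition, \<open>m < c\<close> and \<open>c < n\<close> are the signs of \<open>A1\<close> and
    \<open>A2\<close>, and \<open>mn1\<close> says that their product is - 1.\<close>
  define m n where "m = c - A1" and "n = c - A2"
  have mn: "0 < m" "m < c" "c < n" using assms \<open>A2 < 0\<close> \<open>0 < A1\<close> by (auto simp: m_def n_def A1_def)
  have mn1: "(c - m) * (n - c) = 1" using sq by (simp add: m_def n_def A1_def A2_def field_simps)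
  have A: "A = m + n - 2 * c" by (simp add: m_def n_def A1_def A2_def field_simps)
  obtain \<phi> \<phi>' k C where p: "\<And>x. 0 < \<phi> x" "\<And>x. \<phi> x \<le> m"
    "\<And>x. (\<phi> has_real_derivative \<phi>' x) (at x)"
    "\<And>x. (\<phi>' has_real_derivative \<phi> x -
        (- A * \<phi> x + 3/2 * (\<phi> x)\<^sup>2 + \<phi> x / (c - \<phi> x) + (\<phi> x / (c - \<phi> x))\<^sup>2 / 2) / c) (at x)"
    "0 < k" "\<And>x. \<phi> x \<le> 4 * m * exp (- (k * \<bar>x\<bar>))" "\<And>x. \<bar>\<phi>' x\<bar> \<le> C * \<phi> x"
    unfolding A by (rule solitary_profile[OF mn mn1]) blast
  define \<eta> where "\<eta> x = \<phi> x / (c - \<phi> x)" for x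
  define \<eta>' where "\<eta>' x = c * \<phi>' x / (c - \<phi> x)\<^sup>2" for x
  have ne: "c - \<phi> x \<noteq> 0" for x using p(2)[of x] mn by simp
  have deta: "(\<eta> has_real_derivative \<eta>' x) (at x)" for x
    unfolding \<eta>_def \<eta>'_def using ne[of x]
    by (auto intro!: derivative_eq_intros p(3) simp: field_simps power2_eq_square)
  have cont: "continuous_on UNIV \<phi>" "continuous_on UNIV \<phi>'" "continuous_on UNIV \<eta>"
    using p(3,4) deta DERIV_isCont by (blast intro: continuous_at_imp_continuous_on)+
  have ceta': "continuous_on UNIV \<eta>'"
    unfolding \<eta>'_def using ne by (intro continuous_intros cont) auto
  have "C \<ge> 0" using p(7)[of 0] p(1)[of 0] by (smt (verit) zero_le_mult_iff)
  have b1: "\<bar>\<phi> x\<bar> \<le> 4 * m * exp (- (k * \<bar>x\<bar>))" for x using p(1,6)[of x] by simp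
  have b2: "\<bar>\<phi>' x\<bar> \<le> C * (4 * m) * exp (- (k * \<bar>x\<bar>))" for x
    using order_trans[OF p(7) mult_left_mono[OF p(6) \<open>C \<ge> 0\<close>]] by (simp add: mult.assoc)
  have b3: "\<bar>\<eta> x\<bar> \<le> 4 * m / (c - m) * exp (- (k * \<bar>x\<bar>))" for x
  proof -
    have "\<bar>\<eta> x\<bar> = \<bar>\<phi> x\<bar> / (c - \<phi> x)" using p(2)[of x] mn by (simp add: \<eta>_def)
    also have "\<dots> \<le> (4 * m * exp (- (k * \<bar>x\<bar>))) / (c - m)"
      using b1[of x] p(2)[of x] mn by (intro frac_le) auto
    finally show ?thesis by simp
  qed
  have b4: "\<bar>\<eta>' x\<bar> \<le> c * (C * (4 * m)) / (c - m)\<^sup>2 * exp (- (k * \<bar>x\<bar>))" for x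
  proof -
    have "\<bar>\<eta>' x\<bar> = c * \<bar>\<phi>' x\<bar> / (c - \<phi> x)\<^sup>2" using \<open>c > 0\<close> by (simp add: \<eta>'_def abs_mult)
    also have "\<dots> \<le> (c * (C * (4 * m) * exp (- (k * \<bar>x\<bar>)))) / (c - m)\<^sup>2"
      using b2[of x] p(2)[of x] mn \<open>c > 0\<close> \<open>C \<ge> 0\<close> by (intro frac_le mult_left_mono power_mono) auto
    finally show ?thesis by (simp add: mult.assoc)
  qed
  note lphi = tendsto_0_of_exp_bound[OF p(5) b1] and leta = tendsto_0_of_exp_bound[OF p(5) b3]
  have H1: "H1_fun \<phi>" "H1_fun \<eta>"
    by (rule H1_funI[OF p(3)] H1_funI[OF deta] integrable_square_of_exp_bound[OF p(5)] b1 b2 b3 b4 cont ceta')+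
  let ?F = "wave_source A \<phi> \<eta>"
  have cF: "continuous_on UNIV ?F" by (intro continuous_on_wave_source cont)
  note lF = wave_source_tendsto[OF lphi(1) leta(1), of A] wave_source_tendsto[OF lphi(2) leta(2), of A]
  obtain M where M: "\<And>x. \<bar>?F x\<bar> \<le> M"
    using continuous_limits_imp_bounded[OF cF lF] by blast
  \<comment> \<open>The profile equation says that v = c \<phi> + 1/2 satisfies v'' = v - F, and v
    shares the limit 1/2 of the source, so uniqueness applies.\<close>
  have "pconv ?F x = c * \<phi> x + 1/2" for x
  proof (rule pconv_eqI[OF _ _ cF M lF])
    show "((\<lambda>x. c * \<phi> x + 1/2) has_real_derivative c * \<phi>' x) (at x)" for x
      using DERIV_add[OF DERIV_cmult[OF p(3)] DERIV_const] by simp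
    show "((\<lambda>x. c * \<phi>' x) has_real_derivative c * \<phi> x + 1/2 - ?F x) (at x)" for x
      by (rule DERIV_cong[OF DERIV_cmult[OF p(4)]])
        (use \<open>c > 0\<close> in \<open>simp add: wave_source_def \<eta>_def[symmetric] right_diff_distrib power2_eq_square; simp add: algebra_simps\<close>)
    show "((\<lambda>x. c * \<phi> x + 1/2) \<longlongrightarrow> 1/2) at_top" "((\<lambda>x. c * \<phi> x + 1/2) \<longlongrightarrow> 1/2) at_bot"
      using tendsto_add[OF tendsto_mult_right_zero[OF lphi(1), of c] tendsto_const[of "1/2"]]
        tendsto_add[OF tendsto_mult_right_zero[OF lphi(2), of c] tendsto_const[of "1/2"]] by simp_all
  qed
  then have "(\<lambda>x. - c * \<phi> x + pconv ?F x) = (\<lambda>_. 1/2)" by auto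
  then have e1: "distr_deriv_zero (\<lambda>x. - c * \<phi> x + pconv ?F x)" using distr_deriv_zero_const by simp
  have "(\<lambda>x. - c * \<eta> x + (1 + \<eta> x) * \<phi> x) = (\<lambda>_. 0)"
    using ne by (auto simp: \<eta>_def field_simps)
  then have e2: "distr_deriv_zero (\<lambda>x. - c * \<eta> x + (1 + \<eta> x) * \<phi> x)" using distr_deriv_zero_const by simp
  have "\<phi> 0 \<noteq> 0" using p(1)[of 0] by simp
  then have "solitary_wave A c \<phi> \<eta>"
    unfolding solitary_wave_def using H1 cont lphi leta e1 e2 unfolding wave_source_def[abs_def] by blast
  then show ?thesis by blast
qed

section \<open>Reflection symmetry and conclusion\<close>

lemma H1_fun_minus: "H1_fun f \<Longrightarrow> H1_fun (\<lambda>x. - f x)"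
proof -
  assume "H1_fun f"
  then obtain g where "L2_fun f" "L2_fun g" and g: "\<And>\<psi>. test_fun \<psi> \<Longrightarrow>
      (LINT x|lborel. f x * deriv \<psi> x) = - (LINT x|lborel. g x * \<psi> x)"
    unfolding H1_fun_def by blast
  then have "L2_fun (\<lambda>x. - f x)" "L2_fun (\<lambda>x. - g x)" by (auto simp: L2_fun_def)
  moreover have "(LINT x|lborel. - f x * deriv \<psi> x) = - (LINT x|lborel. - g x * \<psi> x)" if "test_fun \<psi>" for \<psi>
    using g[OF that] by simp
  ultimately show ?thesis unfolding H1_fun_def by blast
qed

text \<open>In the first equation the products A \<phi> and c \<phi> and the squares are unchanged,
  so it stays literally the same. The second one changes sign as a whole, which a vanishing
  distributional derivative tolerates.\<close>

lemma solitary_wave_reflect: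
  assumes "solitary_wave A c \<phi> \<eta>"
  shows "solitary_wave (- A) (- c) (\<lambda>x. - \<phi> x) \<eta>"
proof -
  have e2: "distr_deriv_zero (\<lambda>x. - c * \<eta> x + (1 + \<eta> x) * \<phi> x)"
    using assms by (simp add: solitary_wave_def)
  have "distr_deriv_zero (\<lambda>x. - (- c) * \<eta> x + (1 + \<eta> x) * - \<phi> x)"
    unfolding distr_deriv_zero_def
  proof (intro allI impI)
    fix \<psi> assume "test_fun \<psi>"
    then have "(LINT x|lborel. - ((- c * \<eta> x + (1 + \<eta> x) * \<phi> x) * deriv \<psi> x)) = 0"
      using e2 by (simp add: distr_deriv_zero_def)
    moreover have "(- (- c) * \<eta> x + (1 + \<eta> x) * - \<phi> x) * deriv \<psi> x
        = - ((- c * \<eta> x + (1 + \<eta> x) * \<phi> x) * deriv \<psi> x)" for x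
      by (simp add: algebra_simps)
    ultimately show "(LINT x|lborel. (- (- c) * \<eta> x + (1 + \<eta> x) * - \<phi> x) * deriv \<psi> x) = 0"
      by presburger
  qed
  then show ?thesis
    using assms H1_fun_minus[of \<phi>]
    by (auto simp: solitary_wave_def intro!: continuous_intros tendsto_minus_cancel[where a = 0])
qed

theorem theorem2p5:
  fixes A :: real
  assumes "A > 0"
  shows "(\<forall>c::real. (\<exists>\<phi> \<eta>. solitary_wave A c \<phi> \<eta>) \<longleftrightarrow>
            (c > (- A + sqrt (A\<^sup>2 + 4)) / 2 \<or> c < (- A - sqrt (A\<^sup>2 + 4)) / 2))
       \<and> (\<forall>c \<phi> \<eta>. solitary_wave A c \<phi> \<eta> \<longrightarrow> smooth_fun \<phi> \<and> smooth_fun \<eta>)"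
proof (intro conjI allI impI)
  have "\<bar>A\<bar> < sqrt (A\<^sup>2 + 4)" by (rule real_less_rsqrt) (simp add: power2_eq_square)
  \<comment> \<open>The thresholds have opposite signs, so each speed condition fixes the sign of
    c.\<close>
  then have sgn: "(- A + sqrt (A\<^sup>2 + 4)) / 2 > 0" "(- A - sqrt (A\<^sup>2 + 4)) / 2 < 0" by auto
  fix c
  show "(\<exists>\<phi> \<eta>. solitary_wave A c \<phi> \<eta>) \<longleftrightarrow>
      (c > (- A + sqrt (A\<^sup>2 + 4)) / 2 \<or> c < (- A - sqrt (A\<^sup>2 + 4)) / 2)"
  proof
    assume "\<exists>\<phi> \<eta>. solitary_wave A c \<phi> \<eta>"
    then obtain \<phi> \<eta> where sw: "solitary_wave A c \<phi> \<eta>" by blast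
    consider "c > 0" | "c < 0" using no_solitary_wave_zero_speed sw by (cases c "0::real" rule: linorder_cases) auto
    then show "c > (- A + sqrt (A\<^sup>2 + 4)) / 2 \<or> c < (- A - sqrt (A\<^sup>2 + 4)) / 2"
    proof cases
      case 1
      then show ?thesis using solitary_wave_speed_bound[OF sw] by blast
    next
      case 2
      \<comment> \<open>The upper threshold for - A is minus the lower threshold for A.\<close>
      then show ?thesis using solitary_wave_speed_bound[OF solitary_wave_reflect[OF sw]] by simp
    qed
  next
    assume "c > (- A + sqrt (A\<^sup>2 + 4)) / 2 \<or> c < (- A - sqrt (A\<^sup>2 + 4)) / 2"
    then show "\<exists>\<phi> \<eta>. solitary_wave A c \<phi> \<eta>"
    proof
      assume "c > (- A + sqrt (A\<^sup>2 + 4)) / 2"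
      then show ?thesis using sgn by (intro solitary_wave_exists_positive_speed) auto
    next
      assume "c < (- A - sqrt (A\<^sup>2 + 4)) / 2"
      then have "\<exists>\<phi> \<eta>. solitary_wave (- A) (- c) \<phi> \<eta>"
        using sgn by (intro solitary_wave_exists_positive_speed) auto
      then show ?thesis using solitary_wave_reflect[of "- A" "- c"] by fastforce
    qed
  qed
next
  fix c \<phi> \<eta> assume sw: "solitary_wave A c \<phi> \<eta>"
  consider "c > 0" | "c < 0" using no_solitary_wave_zero_speed sw by (cases c "0::real" rule: linorder_cases) auto
  then have "smooth_fun \<phi> \<and> smooth_fun \<eta>"
  proof cases
    case 1
    then show ?thesis using solitary_wave_smooth_positive_speed[OF sw] by blast
  next
    case 2
    then have s: "smooth_fun (\<lambda>x. - \<phi> x)" "smooth_fun \<eta>"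
      using solitary_wave_smooth_positive_speed[OF solitary_wave_reflect[OF sw]] by auto
    then have "diff_class n \<phi>" for n
      using diff_class_minus[of n "\<lambda>x. - \<phi> x"] by (simp add: smooth_fun_iff_diff_class)
    then show ?thesis using s by (simp add: smooth_fun_iff_diff_class)
  qed
  then show "smooth_fun \<phi>" "smooth_fun \<eta>" by auto
qed

end
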